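(* Let $\mathcal{D}=\{\alpha_1,\ldots,\alpha_m\}$ be a dissection of a convex $n$-gon $P_n$ of type $\{d_1,\ldots,d_m\}$, with associated indeterminates $x_1,\ldots,x_m$, respectively, and indeterminate weights $q_1,\ldots,q_n$ on the boundary edges $e_1,\ldots,e_n$. Set $\varepsilon=\prod_{k=1}^n q_k$ and $c=\prod_{l=1}^m x_l^{d_l-2}$. Then the following holds for the $2\times2$-minors $d(e,f)$ of the weight matrix $W_{\mathcal{D}}(x;q)$ associated to boundary edges of $P_n$. (a) For every boundary edge $e$ of $P_n$, $d(e,e)=-\varepsilon c$. (b) For boundary edges $e=(i,i+1)\ne f=(j,j+1)$ of $P_n$: $d(e,f)\ne 0$ if and only if there exists a zig-zag sequence from $e$ to $f$, i.e. a sequence $$e=z_0,z_1,\ldots,z_{s-1},z_s=f$$ with $s\in\mathbb{N}_0$, where $z_1,\ldots,z_{s-1}$ are diagonals of the dissection, and pieces $p_0,\ldots,p_{s-1}\in\mathcal{D}$, such that for every $k\in\{0,1,\ldots,s-1\}$: (i) $z_k$ and $z_{k+1}$ belong to the common piece $p_k$; (ii) the pieces $p_0,\ldots,p_{s-1}$ are pairwise different; (iii) $z_k$ is incident to $z_{k+1}$. (c) For boundary edges $e=(i,i+1)\ne f=(j,j+1)$ of $P_n$: if there exists a zig-zag sequence from $e$ to $f$, then $$d(e,f)=q_iq_j\prod_{k=i+1}^{j-1}q_k^2\prod_{\beta}x_\beta^{2(d_\beta-2)},$$ where $k$ runs over the indices $i+1,i+2,\ldots,j-1$ (modulo $n$)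 met counterclockwise strictly between $i$ and $j$ (no index if $j=i+1$), and $\beta$ runs over all zig pieces for $(e,f)$, i.e. those pieces of $\mathcal{D}$ which have at most one vertex on the counterclockwise route from $j+1$ to $i$ around $P_n$.
   Context: $P_n$ is a convex $n$-gon ($n\ge3$) with vertices labelled $1,2,\ldots,n$ in counterclockwise order, labels being taken modulo $n$. A dissection $\mathcal{D}$ of $P_n$ is obtained by drawing $m-1$ ($m\ge 1$) pairwise noncrossing diagonals, which cut $P_n$ into $m$ polygons $\alpha_1,\ldots,\alpha_m$, called the pieces of the dissection; one writes $\mathcal{D}=\{\alpha_1,\ldots,\alpha_m\}$. If $\alpha_l$ has $d_l$ vertices, it is called a piece of degree $d_l$; the multiset $\{d_1,\ldots,d_m\}$ is the type of $\mathcal{D}$. For a piece $\beta$, its degree is also written $d_\beta$ and its indeterminate $x_\beta$. For vertices $i,j$, a (counterclockwise) walk from $i$ to $j$ around $P_n$ is a sequence $w=(p_{i+1},p_{i+2},\ldots,p_{j-1})$ of pieces of $\mathcal{D}$, indexed by the vertices strictly between $i$ and $j$ when going counterclockwise from $i$ to $j$ (labels modulo $n$), such that: (i) $p_k$ is incident to vertex $k$ (i.e. $k$ is a vertex of $p_k$) for all $k\in\{i+1,\ldots,j-1\}$; (ii) each piece $\alpha\in\mathcal{D}$ of degree $d$ appears at most $d-2$ times among $p_{i+1},\ldots,p_{j-1}$. By convention, for $i=j$ there is no walk from $i$ to $i$; for $j=i+1$ (modulo $n$) the empty sequence is the unique walk from $i$ to $i+1$. To each piece $\alpha_l$ an indeterminate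 $x_l=x(\alpha_l)$ is associated, and to each boundary edge $e_i=(i,i+1)$ of $P_n$ (indices modulo $n$) an indeterminate $q_i$. The weight of a walk $w=(p_{i+1},\ldots,p_{j-1})$ from $i$ to $j$ is the monomial $x^wq^w$ with $x^w=\prod_{k=i+1}^{j-1}x(p_k)$ and $q^w=\prod_{s=i}^{j-1}q_s$ (products taken counterclockwise from $i$ to $j$, indices modulo $n$; so $q^w$ is the product of the weights of the edges traversed). The weight matrix $W_{\mathcal{D}}(x;q)=(v_{i,j})_{1\le i,j\le n}$ has entries $v_{i,j}=\sum_w x^wq^w$, the sum over all walks $w$ from $i$ to $j$ (so $v_{i,i}=0$, $v_{i,i+1}=q_i$). For boundary edges $e=e_i=(i,i+1)$ and $f=e_j=(j,j+1)$ (indices modulo $n$), the associated $2\times 2$-minor is $$d(e,f)=\det\begin{pmatrix}v_{i,j}&v_{i,j+1}\\ v_{i+1,j}&v_{i+1,j+1}\end{pmatrix}.$$ Two edges/diagonals are incident if they share an endpoint; an edge or diagonal belongs to a piece if it is one of the sides of that piece. The counterclockwise route from $j+1$ to $i$ consists of the vertices $j+1,j+2,\ldots,i$ (modulo $n$), both endpoints included (a single vertex if $i=j+1$). *)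

theory Defs
  imports "Jordan_Normal_Form.Determinant" "HOL-Library.Poly_Mapping" "HOL-Library.FuncSet"
begin

section \<open>Dissections of a convex polygon\<close>

text \<open>
  The vertices of the convex \<open>n\<close>-gon are the residues \<open>0, \<dots>, n - 1\<close> in counterclockwise order;
  the label \<open>n\<close> is represented by \<open>0\<close>. Segments between vertices are two-element sets of
  vertices, and a polygon with vertices among those of the \<open>n\<close>-gon is the set of its vertices.
\<close>

text \<open>Number of counterclockwise steps from \<open>i\<close> to \<open>j\<close>, for \<open>i, j < n\<close>.\<close>

definition ccw_dist :: "nat \<Rightarrow> nat \<Rightarrow> nat \<Rightarrow> nat" where
  "ccw_dist n i j = (n + j - i) mod n"

definition succ_vertex :: "nat \<Rightarrow> nat \<Rightarrow> nat" where
  "succ_vertex n i = (i + 1) mod n"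

text \<open>The vertices \<open>i, i + 1, \<dots>, j\<close>; this is \<open>{i}\<close> if \<open>i = j\<close>.\<close>

definition ccw_route :: "nat \<Rightarrow> nat \<Rightarrow> nat \<Rightarrow> nat set" where
  "ccw_route n i j = {k. k < n \<and> ccw_dist n i k \<le> ccw_dist n i j}"

text \<open>The vertices \<open>i + 1, \<dots>, j - 1\<close>; empty if \<open>j\<close> is \<open>i\<close> or \<open>i + 1\<close>.\<close>

definition ccw_between :: "nat \<Rightarrow> nat \<Rightarrow> nat \<Rightarrow> nat set" where
  "ccw_between n i j = {k. k < n \<and> 0 < ccw_dist n i k \<and> ccw_dist n i k < ccw_dist n i j}"

definition boundary_edge :: "nat \<Rightarrow> nat \<Rightarrow> nat set" where
  "boundary_edge n i = {i, succ_vertex n i}"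

definition boundary_edges :: "nat \<Rightarrow> nat set set" where
  "boundary_edges n = boundary_edge n ` {..<n}"

definition diagonals :: "nat \<Rightarrow> nat set set" where
  "diagonals n = {{a, b} |a b. a < n \<and> b < n \<and> a \<noteq> b} - boundary_edges n"

definition crossing :: "nat set \<Rightarrow> nat set \<Rightarrow> bool" where
  "crossing e f \<longleftrightarrow> (\<exists>a b c d. a < b \<and> b < c \<and> c < d \<and>
     (e = {a, c} \<and> f = {b, d} \<or> e = {b, d} \<and> f = {a, c}))"

text \<open>A dissection is given by the set of its drawn diagonals.\<close>

definition dissection :: "nat \<Rightarrow> nat set set \<Rightarrow> bool" where
  "dissection n \<Delta> \<longleftrightarrow> \<Delta> \<subseteq> diagonals n \<and> (\<forall>e\<in>\<Delta>. \<forall>f\<in>\<Delta>. \<not> crossing e f)"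

text \<open>The sides of the polygon with vertex set \<open>S\<close> join cyclically consecutive vertices of \<open>S\<close>.\<close>

definition sides :: "nat \<Rightarrow> nat set \<Rightarrow> nat set set" where
  "sides n S = {{a, b} |a b. a \<in> S \<and> b \<in> S \<and> a \<noteq> b \<and> ccw_between n a b \<inter> S = {}}"

text \<open>
  The polygons into which the diagonals in \<open>\<Delta>\<close> cut the \<open>n\<close>-gon: their sides are boundary edges or
  drawn diagonals, and they are not cut further by a drawn diagonal. (A drawn diagonal that meets
  the interior of a polygon without crossing one of its sides joins two of its vertices.)
\<close>

definition pieces :: "nat \<Rightarrow> nat set set \<Rightarrow> nat set set" where
  "pieces n \<Delta> = {S. S \<subseteq> {..<n} \<and> 3 \<le> card S \<and> sides n S \<subseteq> boundary_edges n \<union> \<Delta> \<and>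
     (\<forall>\<delta>\<in>\<Delta>. \<delta> \<subseteq> S \<longrightarrow> \<delta> \<in> sides n S)}"

abbreviation degree_of_piece :: "nat set \<Rightarrow> nat" where
  "degree_of_piece \<alpha> \<equiv> card \<alpha>"


section \<open>Weights of walks\<close>

text \<open>
  Polynomials with integer coefficients in one indeterminate \<open>x\<^sub>\<alpha>\<close> for each piece \<open>\<alpha>\<close> and one
  indeterminate \<open>q\<^sub>i\<close> for each boundary edge \<open>(i, i + 1)\<close>, as finitely supported functions from
  monomials (exponent vectors) to coefficients. The product on \<open>\<Rightarrow>\<^sub>0\<close> is the convolution product.
\<close>

datatype indet = Piece_indet "nat set" | Edge_indet nat

type_synonym weight_poly = "(indet \<Rightarrow>\<^sub>0 nat) \<Rightarrow>\<^sub>0 int"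

definition indet_poly :: "indet \<Rightarrow> weight_poly" where
  "indet_poly v = Poly_Mapping.single (Poly_Mapping.single v 1) 1"

definition x_var :: "nat set \<Rightarrow> weight_poly" where
  "x_var \<alpha> = indet_poly (Piece_indet \<alpha>)"

definition q_var :: "nat \<Rightarrow> weight_poly" where
  "q_var i = indet_poly (Edge_indet i)"

text \<open>
  A walk from \<open>i\<close> to \<open>j\<close> is the family of its pieces \<open>p k\<close>, indexed by the vertices \<open>k\<close> strictly
  between \<open>i\<close> and \<open>j\<close>. Outside this index set \<open>p\<close> is \<open>undefined\<close>, so that distinct functions are
  distinct walks, and there is exactly one walk from \<open>i\<close> to \<open>i + 1\<close>.
\<close>

definition walks :: "nat \<Rightarrow> nat set set \<Rightarrow> nat \<Rightarrow> nat \<Rightarrow> (nat \<Rightarrow> nat set) set" where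
  "walks n \<Delta> i j = (if i = j then {} else
     {p \<in> ccw_between n i j \<rightarrow>\<^sub>E pieces n \<Delta>.
        (\<forall>k\<in>ccw_between n i j. k \<in> p k) \<and>
        (\<forall>\<alpha>\<in>pieces n \<Delta>. card {k \<in> ccw_between n i j. p k = \<alpha>} \<le> degree_of_piece \<alpha> - 2)})"

definition walk_weight :: "nat \<Rightarrow> nat \<Rightarrow> nat \<Rightarrow> (nat \<Rightarrow> nat set) \<Rightarrow> weight_poly" where
  "walk_weight n i j p =
     (\<Prod>k\<in>ccw_between n i j. x_var (p k)) * (\<Prod>s\<in>insert i (ccw_between n i j). q_var s)"

definition weight_matrix :: "nat \<Rightarrow> nat set set \<Rightarrow> weight_poly mat" where
  "weight_matrix n \<Delta> = mat n n (\<lambda>(i, j). \<Sum>p\<in>walks n \<Delta> i j. walk_weight n i j p)"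

text \<open>The minor \<open>d(e, f)\<close> for the boundary edges \<open>e = (i, i + 1)\<close> and \<open>f = (j, j + 1)\<close>.\<close>

definition edge_minor :: "nat \<Rightarrow> nat set set \<Rightarrow> nat \<Rightarrow> nat \<Rightarrow> weight_poly" where
  "edge_minor n \<Delta> i j =
     (let W = weight_matrix n \<Delta>; i' = succ_vertex n i; j' = succ_vertex n j
      in det (mat_of_rows_list 2 [[W $$ (i, j),  W $$ (i, j')],
                                  [W $$ (i', j), W $$ (i', j')]]))"

definition edge_weight_product :: "nat \<Rightarrow> weight_poly" where
  "edge_weight_product n = (\<Prod>k<n. q_var k)"

definition piece_weight_product :: "nat \<Rightarrow> nat set set \<Rightarrow> weight_poly" where
  "piece_weight_product n \<Delta> = (\<Prod>\<alpha>\<in>pieces n \<Delta>. x_var \<alpha> ^ (degree_of_piece \<alpha> - 2))"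


section \<open>Zig-zag sequences\<close>

text \<open>The edges and diagonals \<open>z\<^sub>0, \<dots>, z\<^sub>s\<close> and the pieces \<open>p\<^sub>0, \<dots>, p\<^bsub>s-1\<^esub>\<close>, with \<open>s = length ps\<close>.\<close>

definition zigzag_sequence ::
  "nat \<Rightarrow> nat set set \<Rightarrow> nat set \<Rightarrow> nat set \<Rightarrow> nat set list \<Rightarrow> nat set list \<Rightarrow> bool" where
  "zigzag_sequence n \<Delta> e f zs ps \<longleftrightarrow>
     length zs = length ps + 1 \<and> zs ! 0 = e \<and> zs ! length ps = f \<and>
     (\<forall>k. 0 < k \<and> k < length ps \<longrightarrow> zs ! k \<in> \<Delta>) \<and>
     set ps \<subseteq> pieces n \<Delta> \<and>
     (\<forall>k<length ps. zs ! k \<in> sides n (ps ! k) \<and> zs ! (k + 1) \<in> sides n (ps ! k)) \<and>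
     distinct ps \<and>
     (\<forall>k<length ps. zs ! k \<inter> zs ! (k + 1) \<noteq> {})"

definition zigzag_exists :: "nat \<Rightarrow> nat set set \<Rightarrow> nat set \<Rightarrow> nat set \<Rightarrow> bool" where
  "zigzag_exists n \<Delta> e f \<longleftrightarrow> (\<exists>zs ps. zigzag_sequence n \<Delta> e f zs ps)"

text \<open>The zig pieces for the boundary edges \<open>(i, i + 1)\<close> and \<open>(j, j + 1)\<close>.\<close>

definition zig_pieces :: "nat \<Rightarrow> nat set set \<Rightarrow> nat \<Rightarrow> nat \<Rightarrow> nat set set" where
  "zig_pieces n \<Delta> i j =
     {\<beta> \<in> pieces n \<Delta>. card (\<beta> \<inter> ccw_route n (succ_vertex n j) i) \<le> 1}"

end

theory Submission
  imports Defs
begin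

text \<open>
  Root the polygon at the edge \<open>e = (i, i + 1)\<close> and order the vertices linearly from \<open>i + 1\<close> to \<open>i\<close>. The
  minors \<open>d(e, f)\<close> are then, up to the weights of the edges, the determinants of adjacent columns of
  the two rows \<open>i\<close> and \<open>i + 1\<close>. The dissected polygon arises from the digon on \<open>e\<close> by glueing ears,
  that is, pieces whose sides are all on the boundary except for one side \<open>(u, w)\<close>. If \<open>C\<close> and \<open>C'\<close>
  are the columns before and after glueing an ear \<open>\<alpha>\<close> of degree \<open>d\<close>, then \<open>C'(j) = C(j)\<close> for \<open>j\<close> up to
  \<open>u\<close>, \<open>C'(j) = x\<^sub>\<alpha>\<^bsup>d-2\<^esup> C(j)\<close> for \<open>j\<close> from \<open>w\<close> on, and \<open>C'(j) = x\<^sub>\<alpha>\<^bsup>t\<^esup> (C(w) + x\<^sub>\<alpha> C(u))\<close> at the new vertex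
  preceded by \<open>t\<close> new vertices. So the minor at a new edge \<open>f\<close> is the one at \<open>(u, w)\<close>, multiplied
  by \<open>1\<close>, \<open>x\<^sub>\<alpha>\<^bsup>2(d-2)\<^esup>\<close> or \<open>0\<close> according as \<open>f\<close> contains \<open>u\<close>, \<open>w\<close> or neither, and a zig-zag sequence to \<open>f\<close> is one to \<open>(u, w)\<close>
  extended by \<open>\<alpha>\<close>, which is possible exactly if \<open>f\<close> meets \<open>{u, w}\<close>.
\<close>

section \<open>Weighted assignments of pieces to vertices\<close>

text \<open>Walks with index set and pieces set free: \<open>S\<close> need not be an arc, nor
  \<open>P\<close> come from a dissection, so that pieces can be split off one at a time.\<close>

definition assignments :: "'v set set \<Rightarrow> 'v set \<Rightarrow> ('v \<Rightarrow> 'v set) set" where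
  "assignments P S = {p \<in> S \<rightarrow>\<^sub>E P. (\<forall>k\<in>S. k \<in> p k) \<and>
     (\<forall>\<alpha>\<in>P. card {k \<in> S. p k = \<alpha>} \<le> card \<alpha> - 2)}"

text \<open>Only the x-part of the weights is summed; the q-part depends on the endpoints alone and
  is factored out of the matrix entries later.\<close>

definition assignment_sum :: "('v set \<Rightarrow> 'a::comm_ring_1) \<Rightarrow> 'v set set \<Rightarrow> 'v set \<Rightarrow> 'a" where
  "assignment_sum x P S = (\<Sum>p\<in>assignments P S. \<Prod>k\<in>S. x (p k))"

lemma assignment_sum_empty [simp]: "assignment_sum x P {} = 1"
proof -
  have "assignments P {} = {\<lambda>_. undefined}"
    by (auto simp: assignments_def)
  then show ?thesis by (simp add: assignment_sum_def)
qed

lemma assignment_sum_uncovered: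
  assumes "k \<in> S" "k \<notin> \<Union>P"
  shows "assignment_sum x P S = 0"
proof -
  have "assignments P S = {}"
    using assms by (fastforce simp: assignments_def PiE_iff)
  then show ?thesis by (simp add: assignment_sum_def)
qed

text \<open>Sort the assignments by the set \<open>T\<close> of vertices sent to
  \<open>\<alpha>\<close>: incidence and the bound for \<open>\<alpha>\<close> restrict
  \<open>T\<close>, and the rest is an assignment of the other pieces to
  \<open>S - T\<close>.\<close>

lemma assignment_sum_insert:
  fixes x :: "'v set \<Rightarrow> 'a::comm_ring_1"
  assumes "\<alpha> \<notin> P" "finite P" "finite S"
  shows "assignment_sum x (insert \<alpha> P) S =
    (\<Sum>T\<in>{T. T \<subseteq> S \<inter> \<alpha> \<and> card T \<le> card \<alpha> - 2}. x \<alpha> ^ card T * assignment_sum x P (S - T))"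
proof -
  let ?I = "{T. T \<subseteq> S \<inter> \<alpha> \<and> card T \<le> card \<alpha> - 2}"
  let ?join = "\<lambda>(T, p) k. if k \<in> T then \<alpha> else p k"
  let ?split = "\<lambda>p. ({k \<in> S. p k = \<alpha>}, restrict p (S - {k \<in> S. p k = \<alpha>}))"
  have finI: "finite ?I"
    using assms(3) by (auto intro: finite_subset[of _ "Pow S"])
  have fin: "finite (assignments P T)" if "finite T" for T
    using that assms(2) by (auto simp: assignments_def intro!: finite_PiE)
  \<comment> \<open>As \<open>\<alpha>\<close> is not in \<open>P\<close>, the rest never uses it,
    so \<open>T\<close> can be recovered from the joined assignment.\<close>
  have outside: "p k \<noteq> \<alpha>" if "p \<in> assignments P (S - T)" "k \<in> S - T" for p k T
    using that assms(1) by (auto simp: assignments_def PiE_iff)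
  have hit: "{k \<in> S. ?join (T, p) k = \<alpha>} = T"
    if "T \<in> ?I" "p \<in> assignments P (S - T)" for T p
    using that outside[OF that(2)] by auto
  have "(\<Sum>T\<in>?I. x \<alpha> ^ card T * assignment_sum x P (S - T)) =
      (\<Sum>T\<in>?I. \<Sum>p\<in>assignments P (S - T). x \<alpha> ^ card T * (\<Prod>k\<in>S - T. x (p k)))"
    by (simp add: assignment_sum_def sum_distrib_left)
  also have "\<dots> = (\<Sum>(T, p)\<in>Sigma ?I (\<lambda>T. assignments P (S - T)).
      x \<alpha> ^ card T * (\<Prod>k\<in>S - T. x (p k)))"
    using assms(3) fin by (intro sum.Sigma finI) auto
  also have "\<dots> = (\<Sum>p\<in>assignments (insert \<alpha> P) S. \<Prod>k\<in>S. x (p k))"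
  proof (rule sum.reindex_bij_witness[where i = ?split and j = ?join])
    fix z assume "z \<in> Sigma ?I (\<lambda>T. assignments P (S - T))"
    then obtain T p where z: "z = (T, p)" and T: "T \<in> ?I" and p: "p \<in> assignments P (S - T)"
      by auto
    have ext: "p k = undefined" if "k \<notin> S - T" for k
      using p that by (auto simp: assignments_def PiE_iff extensional_def)
    have T': "T \<subseteq> S" "finite T" using T assms(3) by (auto intro: finite_subset)
    show "?split (?join z) = z"
      unfolding z hit[OF T p] by (auto simp: restrict_def ext fun_eq_iff)
    have "card {k \<in> S. ?join z k = \<beta>} \<le> card \<beta> - 2" if "\<beta> \<in> insert \<alpha> P" for \<beta>
    proof (cases "\<beta> = \<alpha>")
      case True
      then show ?thesis unfolding z True hit[OF T p] using T by simp
    next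
      case False
      then have "{k \<in> S. ?join z k = \<beta>} = {k \<in> S - T. p k = \<beta>}"
        by (auto simp: z)
      then show ?thesis using p that False by (auto simp: assignments_def)
    qed
    moreover have "?join z \<in> S \<rightarrow>\<^sub>E insert \<alpha> P" "\<forall>k\<in>S. k \<in> ?join z k"
      using T p by (auto simp: z assignments_def PiE_iff extensional_def)
    ultimately show "?join z \<in> assignments (insert \<alpha> P) S"
      unfolding assignments_def by blast
    have "(\<Prod>k\<in>S. x (?join z k)) = (\<Prod>k\<in>S - T. x (?join z k)) * (\<Prod>k\<in>T. x (?join z k))"
      using T' assms(3) by (simp add: prod.subset_diff)
    also have "\<dots> = (\<Prod>k\<in>S - T. x (p k)) * x \<alpha> ^ card T"
      by (simp add: z)
    finally show "(\<Prod>k\<in>S. x (?join z k)) =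
        (case z of (T, p) \<Rightarrow> x \<alpha> ^ card T * (\<Prod>k\<in>S - T. x (p k)))"
      by (simp add: z mult.commute)
  next
    fix p assume p: "p \<in> assignments (insert \<alpha> P) S"
    let ?T = "{k \<in> S. p k = \<alpha>}"
    have T: "?T \<in> ?I"
      using p by (auto simp: assignments_def)
    have ext: "p k = undefined" if "k \<notin> S" for k
      using p that by (auto simp: assignments_def PiE_iff extensional_def)
    show "?join (?split p) = p"
      by (auto simp: ext fun_eq_iff)
    have "{k \<in> S - ?T. restrict p (S - ?T) k = \<beta>} = {k \<in> S. p k = \<beta>}" if "\<beta> \<in> P" for \<beta>
      using that assms(1) by auto
    then have "\<forall>\<beta>\<in>P. card {k \<in> S - ?T. restrict p (S - ?T) k = \<beta>} \<le> card \<beta> - 2"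
      using p by (simp add: assignments_def)
    moreover have "restrict p (S - ?T) \<in> (S - ?T) \<rightarrow>\<^sub>E P" "\<forall>k\<in>S - ?T. k \<in> restrict p (S - ?T) k"
      using p by (auto simp: assignments_def PiE_iff)
    ultimately have "restrict p (S - ?T) \<in> assignments P (S - ?T)"
      unfolding assignments_def by blast
    then show "?split p \<in> Sigma ?I (\<lambda>T. assignments P (S - T))"
      using T by simp
  qed
  finally show ?thesis by (simp add: assignment_sum_def)
qed

text \<open>A vertex of \<open>N\<close> lies on no piece but the ear, so only sets \<open>T\<close>
  containing \<open>N \<inter> S\<close> contribute, and \<open>card T \<le> card N\<close> leaves
  few of them: the empty set, the set \<open>N\<close>, or \<open>N \<inter> S\<close> with or
  without \<open>u\<close>.\<close>

lemma assignment_sum_ear: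
  fixes x :: "'v set \<Rightarrow> 'a::comm_ring_1"
  assumes "finite P" "finite S" "N \<inter> \<Union>P = {}" "\<alpha> = insert u (insert w N)" "finite N" "N \<noteq> {}"
    "u \<notin> N" "w \<notin> N" "u \<noteq> w"
  shows "N \<inter> S = {} \<Longrightarrow> u \<notin> S \<Longrightarrow> w \<notin> S \<Longrightarrow>
      assignment_sum x (insert \<alpha> P) S = assignment_sum x P S"
    and "N \<subseteq> S \<Longrightarrow>
      assignment_sum x (insert \<alpha> P) S = x \<alpha> ^ card N * assignment_sum x P (S - N)"
    and "w \<notin> S \<Longrightarrow> \<not> N \<subseteq> S \<Longrightarrow>
      assignment_sum x (insert \<alpha> P) S = x \<alpha> ^ card (N \<inter> S) *
        (assignment_sum x P (S - N) +
          (if u \<in> S then x \<alpha> * assignment_sum x P (S - N - {u}) else 0))"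
proof -
  have \<alpha>: "\<alpha> \<notin> P" using assms(3,4,6) by auto
  have c: "card \<alpha> - 2 = card N" using assms by simp
  let ?I = "{T. T \<subseteq> S \<inter> \<alpha> \<and> card T \<le> card N}"
  let ?g = "\<lambda>T. x \<alpha> ^ card T * assignment_sum x P (S - T)"
  have finI: "finite ?I"
    using assms(2) by (auto intro: finite_subset[of _ "Pow S"])
  \<comment> \<open>\<open>J\<close> may be any part of the index set that contains all
    \<open>T\<close> covering \<open>N \<inter> S\<close>; every other \<open>T\<close> leaves a
    vertex of \<open>N\<close> without a piece.\<close>
  have sum: "assignment_sum x (insert \<alpha> P) S = sum ?g J"
    if J: "J \<subseteq> ?I" "\<And>T. T \<in> ?I \<Longrightarrow> N \<inter> S \<subseteq> T \<Longrightarrow> T \<in> J" for J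
  proof -
    have "sum ?g J = sum ?g ?I"
    proof (rule sum.mono_neutral_left[OF finI J(1)], rule ballI)
      fix T assume "T \<in> ?I - J"
      then obtain k where "k \<in> N \<inter> S" "k \<notin> T" using J(2) by blast
      then have "k \<in> S - T" "k \<notin> \<Union>P" using assms(3) by auto
      then show "?g T = 0" by (simp add: assignment_sum_uncovered)
    qed
    then show ?thesis
      using assignment_sum_insert[OF \<alpha> assms(1,2), of x] c by simp
  qed
  show "assignment_sum x (insert \<alpha> P) S = assignment_sum x P S"
    if "N \<inter> S = {}" "u \<notin> S" "w \<notin> S"
  proof -
    have "S \<inter> \<alpha> = {}" using that assms(4) by auto
    then show ?thesis using sum[of "{{}}"] by simp
  qed
  show "assignment_sum x (insert \<alpha> P) S = x \<alpha> ^ card N * assignment_sum x P (S - N)"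
    if "N \<subseteq> S"
  proof -
    have "T = N" if "T \<in> ?I" "N \<inter> S \<subseteq> T" for T
    proof -
      have "finite T" using that assms(2) by (auto intro: finite_subset)
      moreover have "N \<subseteq> T" "card T \<le> card N" using that \<open>N \<subseteq> S\<close> by auto
      ultimately show ?thesis by (metis card_seteq)
    qed
    then show ?thesis using sum[of "{N}"] that assms(4) by auto
  qed
  show "assignment_sum x (insert \<alpha> P) S = x \<alpha> ^ card (N \<inter> S) *
        (assignment_sum x P (S - N) +
          (if u \<in> S then x \<alpha> * assignment_sum x P (S - N - {u}) else 0))"
    if "w \<notin> S" "\<not> N \<subseteq> S"
  proof -
    \<comment> \<open>A vertex of \<open>N\<close> is missing from \<open>S\<close>, so the ear can
      be used once more, namely at \<open>u\<close>.\<close>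
    have less: "card (N \<inter> S) < card N"
      using that(2) assms(5) by (intro psubset_card_mono) auto
    have D: "S - N \<inter> S = S - N" by auto
    have cu: "card (insert u (N \<inter> S)) = Suc (card (N \<inter> S))"
      using assms by simp
    have T: "T = N \<inter> S \<or> u \<in> S \<and> T = insert u (N \<inter> S)" if "T \<in> ?I" "N \<inter> S \<subseteq> T" for T
      using that \<open>w \<notin> S\<close> assms(4) by auto
    show ?thesis
    proof (cases "u \<in> S")
      case True
      have eq: "S - insert u (N \<inter> S) = S - N - {u}" by auto
      have "assignment_sum x (insert \<alpha> P) S = sum ?g {N \<inter> S, insert u (N \<inter> S)}"
        using T True less cu assms(4) by (intro sum) auto
      also have "\<dots> = ?g (N \<inter> S) + ?g (insert u (N \<inter> S))"
        using assms(7) by (subst sum.insert) auto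
      finally show ?thesis
        using True by (simp only: cu D eq if_True) (simp add: algebra_simps)
    next
      case False
      have "assignment_sum x (insert \<alpha> P) S = sum ?g {N \<inter> S}"
        using T False less assms(4) by (intro sum) auto
      then show ?thesis using False by (simp add: D)
    qed
  qed
qed

section \<open>Glueing ears\<close>

locale vertex_order =
  fixes pos :: "'v \<Rightarrow> nat"
  assumes inj_pos: "inj pos"
begin

lemma pos_eq [simp]: "pos s = pos t \<longleftrightarrow> s = t"
  using inj_pos by (rule inj_eq)

definition between :: "'v \<Rightarrow> 'v \<Rightarrow> 'v set" where
  "between s t = {k. pos s < pos k \<and> pos k < pos t}"

definition consecutive :: "'v set \<Rightarrow> 'v \<Rightarrow> 'v \<Rightarrow> bool" where
  "consecutive S s t \<longleftrightarrow> s \<in> S \<and> t \<in> S \<and> pos s < pos t \<and> between s t \<inter> S = {}"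

lemma consecutiveD: "consecutive S s t \<Longrightarrow> k \<in> S \<Longrightarrow> pos k \<le> pos s \<or> pos t \<le> pos k"
  by (simp add: consecutive_def between_def disjoint_iff) (meson linorder_not_le)

text \<open>The side that closes the polygon: cyclically, the last vertex is followed by the first
  one.\<close>

definition outermost :: "'v set \<Rightarrow> 'v \<Rightarrow> 'v \<Rightarrow> bool" where
  "outermost S s t \<longleftrightarrow> s \<in> S \<and> t \<in> S \<and> pos s < pos t \<and> (\<forall>k\<in>S. pos s \<le> pos k \<and> pos k \<le> pos t)"

definition polygon_sides :: "'v set \<Rightarrow> 'v set set" where
  "polygon_sides S = {{s, t} |s t. consecutive S s t \<or> outermost S s t}"

lemma polygon_sides_subset: "e \<in> polygon_sides S \<Longrightarrow> e \<subseteq> S"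
  by (auto simp: polygon_sides_def consecutive_def outermost_def)

text \<open>\<open>E\<close> collects the bases of the ears. The first ear is glued on the root
  \<open>{a, b}\<close>, which is no diagonal; hence the diagonals of zig-zag sequences are taken
  from \<open>E - {{a, b}}\<close>.\<close>

inductive ear_built :: "'v \<Rightarrow> 'v \<Rightarrow> 'v set \<Rightarrow> 'v set set \<Rightarrow> 'v set set \<Rightarrow> bool" for a b where
  digon: "pos a < pos b \<Longrightarrow> ear_built a b {a, b} {} {}"
| glue: "ear_built a b V E P \<Longrightarrow> consecutive V u w \<Longrightarrow> finite N \<Longrightarrow> N \<noteq> {} \<Longrightarrow> N \<subseteq> between u w \<Longrightarrow>
    ear_built a b (V \<union> N) (insert {u, w} E) (insert (insert u (insert w N)) P)"

text \<open>The last conjunct serves to recognise the digon: as long as \<open>a\<close> and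
  \<open>b\<close> are consecutive, no ear has been glued.\<close>

lemma ear_built_facts:
  assumes "ear_built a b V E P"
  shows "finite V \<and> a \<in> V \<and> b \<in> V \<and> (\<forall>k\<in>V. pos a \<le> pos k \<and> pos k \<le> pos b) \<and> pos a < pos b \<and>
    finite P \<and> (\<forall>\<beta>\<in>P. \<beta> \<subseteq> V) \<and> (\<forall>e\<in>E. e \<subseteq> V) \<and> (P \<noteq> {} \<longrightarrow> between a b \<inter> V \<noteq> {})"
  using assms
proof induction
  case digon
  then show ?case by auto
next
  case (glue V E P u w N)
  have ends: "pos a \<le> pos u" "pos w \<le> pos b" and uw: "u \<in> V" "w \<in> V"
    using glue.IH glue.hyps(2) by (auto simp: consecutive_def)
  have N: "pos u < pos k \<and> pos k < pos w" if "k \<in> N" for k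
    using glue.hyps(5) that by (auto simp: between_def)
  have bounds: "\<forall>k\<in>V \<union> N. pos a \<le> pos k \<and> pos k \<le> pos b"
  proof
    fix k assume "k \<in> V \<union> N"
    then show "pos a \<le> pos k \<and> pos k \<le> pos b"
    proof
      assume "k \<in> V" then show ?thesis using glue.IH by blast
    next
      assume "k \<in> N" then show ?thesis using N[of k] ends by linarith
    qed
  qed
  have "between a b \<inter> (V \<union> N) \<noteq> {}"
  proof -
    obtain k where "k \<in> N" using glue.hyps(4) by blast
    moreover from this have "k \<in> between a b"
      using N[of k] ends by (simp add: between_def)
    ultimately show ?thesis by blast
  qed
  with glue.IH glue.hyps(3) uw bounds show ?case
    by (intro conjI) auto
qed

text \<open>
  The root edge is \<open>(b, a)\<close>. The row of \<open>b\<close> is obtained for \<open>L = UNIV\<close>, the row of \<open>a\<close> for \<open>L = - {a}\<close>,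
  where the value \<open>0\<close> at \<open>j = a\<close> reflects that there is no walk from \<open>a\<close> to \<open>a\<close>.
\<close>

definition column :: "('v set \<Rightarrow> 'a::comm_ring_1) \<Rightarrow> 'v set \<Rightarrow> 'v set set \<Rightarrow> 'v set \<Rightarrow> 'v \<Rightarrow> 'a" where
  "column x L P V j =
     (if j \<in> L then assignment_sum x P {k \<in> V \<inter> L. pos k < pos j} else 0)"

definition minor :: "('v set \<Rightarrow> 'a::comm_ring_1) \<Rightarrow> 'v \<Rightarrow> 'v set set \<Rightarrow> 'v set \<Rightarrow> 'v \<Rightarrow> 'v \<Rightarrow> 'a" where
  "minor x a P V j j' = column x UNIV P V j * column x (- {a}) P V j' -
     column x UNIV P V j' * column x (- {a}) P V j"

text \<open>The vertices from position \<open>pos j\<close> on form the route from \<open>j\<close>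
  to the root vertex \<open>b\<close>, so these are the zig pieces for a second edge that ends in
  \<open>j\<close>.\<close>

definition zig :: "'v set set \<Rightarrow> 'v \<Rightarrow> 'v set set" where
  "zig P j = {\<beta> \<in> P. card (\<beta> \<inter> {k. pos j \<le> pos k}) \<le> 1}"

definition zig_weight :: "('v set \<Rightarrow> 'a::comm_ring_1) \<Rightarrow> 'v set set \<Rightarrow> 'v \<Rightarrow> 'a" where
  "zig_weight x P j = (\<Prod>\<beta>\<in>zig P j. x \<beta> ^ (2 * (card \<beta> - 2)))"

definition zigzag_via ::
  "'v set set \<Rightarrow> 'v set set \<Rightarrow> 'v set \<Rightarrow> 'v set \<Rightarrow> 'v set list \<Rightarrow> 'v set list \<Rightarrow> bool" where
  "zigzag_via D P e f zs ps \<longleftrightarrow>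
     length zs = length ps + 1 \<and> zs ! 0 = e \<and> zs ! length ps = f \<and>
     (\<forall>k. 0 < k \<and> k < length ps \<longrightarrow> zs ! k \<in> D) \<and> set ps \<subseteq> P \<and>
     (\<forall>k<length ps. zs ! k \<in> polygon_sides (ps ! k) \<and> zs ! (k + 1) \<in> polygon_sides (ps ! k)) \<and>
     distinct ps \<and> (\<forall>k<length ps. zs ! k \<inter> zs ! (k + 1) \<noteq> {})"

definition zigzag :: "'v set set \<Rightarrow> 'v set set \<Rightarrow> 'v set \<Rightarrow> 'v set \<Rightarrow> bool" where
  "zigzag D P e f \<longleftrightarrow> (\<exists>zs ps. zigzag_via D P e f zs ps)"

lemma zigzag_mono:
  assumes "zigzag D P e f" "D \<subseteq> D'" "P \<subseteq> P'"
  shows "zigzag D' P' e f"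
proof -
  obtain zs ps where z: "zigzag_via D P e f zs ps"
    using assms(1) by (auto simp: zigzag_def)
  have "\<forall>k. 0 < k \<and> k < length ps \<longrightarrow> zs ! k \<in> D'" "set ps \<subseteq> P'"
    using z assms(2,3) by (simp_all add: zigzag_via_def subset_iff)
  then have "zigzag_via D' P' e f zs ps"
    using z by (simp add: zigzag_via_def)
  then show ?thesis by (auto simp: zigzag_def)
qed

lemma zigzag_refl: "zigzag D P e e"
proof -
  have "zigzag_via D P e e [e] []" by (simp add: zigzag_via_def)
  then show ?thesis unfolding zigzag_def by blast
qed

end

section \<open>The effect of one ear on columns, minors and zig weights\<close>

locale ear = vertex_order pos for pos :: "'v \<Rightarrow> nat" +
  fixes a b :: 'v and V E P and u w :: 'v and N
  assumes built: "ear_built a b V E P"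
    and uw: "consecutive V u w"
    and N: "finite N" "N \<noteq> {}" "N \<subseteq> between u w"
begin

abbreviation new :: "'v set" where "new \<equiv> insert u (insert w N)"

lemma facts: "finite V" "a \<in> V" "k \<in> V \<Longrightarrow> pos a \<le> pos k" "finite P" "\<beta> \<in> P \<Longrightarrow> \<beta> \<subseteq> V"
    "e \<in> E \<Longrightarrow> e \<subseteq> V"
  using ear_built_facts[OF built] by simp_all

lemma u_w: "u \<in> V" "w \<in> V" "pos u < pos w" "u \<noteq> w"
  using uw by (auto simp: consecutive_def)

lemma N_pos: "k \<in> N \<Longrightarrow> pos u < pos k \<and> pos k < pos w"
  using N by (auto simp: between_def)

lemma u_w_notin_N: "u \<notin> N" "w \<notin> N"
  using N_pos by blast+

lemma V_pos: "k \<in> V \<Longrightarrow> pos k \<le> pos u \<or> pos w \<le> pos k"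
  using uw by (rule consecutiveD)

lemma disjoint: "N \<inter> V = {}"
  using N_pos V_pos by (meson disjoint_iff leD)

lemma pieces_disjoint: "N \<inter> \<Union>P = {}"
  using facts(5) disjoint by blast

lemma new_notin: "new \<notin> P"
  using pieces_disjoint N(2) by auto

lemma card_new: "card new - 2 = card N"
  using u_w_notin_N u_w N by simp

context
  fixes L
  assumes L: "N \<subseteq> L" "w \<in> L"
begin

lemma column_before:
  assumes "j \<in> V" "pos j \<le> pos u"
  shows "column x L (insert new P) (V \<union> N) j = column x L P V j"
proof -
  have "{k \<in> (V \<union> N) \<inter> L. pos k < pos j} = {k \<in> V \<inter> L. pos k < pos j}"
    using assms N_pos by (auto dest!: N_pos)
  moreover have "assignment_sum x (insert new P) {k \<in> V \<inter> L. pos k < pos j} =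
      assignment_sum x P {k \<in> V \<inter> L. pos k < pos j}"
  proof (rule assignment_sum_ear(1)[where \<alpha> = new and u = u and w = w and N = N])
    show "N \<inter> {k \<in> V \<inter> L. pos k < pos j} = {}" using disjoint by auto
  qed (use assms u_w facts(1,4) u_w_notin_N pieces_disjoint N(1,2) in auto)
  ultimately show ?thesis by (simp add: column_def)
qed

text \<open>All of \<open>N\<close> lies before \<open>j\<close> and exhausts the ear, which
  contributes just a factor.\<close>

lemma column_after:
  assumes "j \<in> V" "pos w \<le> pos j"
  shows "column x L (insert new P) (V \<union> N) j = x new ^ card N * column x L P V j"
proof -
  let ?S = "{k \<in> (V \<union> N) \<inter> L. pos k < pos j}"
  have "?S - N = {k \<in> V \<inter> L. pos k < pos j}"
    using disjoint by auto
  moreover have "assignment_sum x (insert new P) ?S =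
      x new ^ card N * assignment_sum x P (?S - N)"
  proof (rule assignment_sum_ear(2)[where \<alpha> = new and u = u and w = w and N = N])
    show "N \<subseteq> ?S"
      using L(1) assms(2) N_pos by (auto intro: less_le_trans)
  qed (use u_w(4) facts(1,4) u_w_notin_N pieces_disjoint N(1,2) in auto)
  ultimately show ?thesis by (simp add: column_def)
qed

text \<open>The new vertices before \<open>j\<close> must use the ear, and since \<open>j\<close>
  itself is left out the ear has a use to spare for \<open>u\<close>. Without it the old pieces
  serve the old vertices before \<open>w\<close>, with it those before \<open>u\<close>.\<close>

lemma column_inside:
  assumes "j \<in> N"
  shows "column x L (insert new P) (V \<union> N) j =
    x new ^ card {k \<in> N. pos k < pos j} * (column x L P V w + x new * column x L P V u)"
proof -
  let ?S = "{k \<in> (V \<union> N) \<inter> L. pos k < pos j}"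
  have j: "pos u < pos j" "pos j < pos w" using N_pos assms by auto
  \<comment> \<open>No old vertex lies between \<open>j\<close> and \<open>w\<close>, so the old
    vertices may be cut off at \<open>w\<close> instead of \<open>j\<close>.\<close>
  have "k \<in> V \<Longrightarrow> pos k < pos j \<longleftrightarrow> pos k < pos w" for k
    using j V_pos[of k] by auto
  then have S: "?S - N = {k \<in> V \<inter> L. pos k < pos w}"
    using disjoint by auto
  have "k \<in> V \<Longrightarrow> pos k < pos w \<and> k \<noteq> u \<longleftrightarrow> pos k < pos u" for k
    using V_pos[of k] u_w(3) pos_eq[of k u] by linarith
  then have S': "?S - N - {u} = {k \<in> V \<inter> L. pos k < pos u}"
    unfolding S by auto
  have NS: "N \<inter> ?S = {k \<in> N. pos k < pos j}"
    using L by auto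
  have u: "u \<in> ?S \<longleftrightarrow> u \<in> L"
    using u_w j by auto
  have "assignment_sum x (insert new P) ?S = x new ^ card (N \<inter> ?S) *
        (assignment_sum x P (?S - N) +
          (if u \<in> ?S then x new * assignment_sum x P (?S - N - {u}) else 0))"
  proof (rule assignment_sum_ear(3)[where \<alpha> = new and u = u and w = w and N = N])
    show "w \<notin> ?S" using j by simp
    show "\<not> N \<subseteq> ?S" using assms by auto
  qed (use u_w(4) facts(1,4) u_w_notin_N pieces_disjoint N(1,2) in auto)
  also have "\<dots> = x new ^ card {k \<in> N. pos k < pos j} *
      (assignment_sum x P {k \<in> V \<inter> L. pos k < pos w} +
        (if u \<in> L then x new * assignment_sum x P {k \<in> V \<inter> L. pos k < pos u} else 0))"
    unfolding NS S'[unfolded S] S u ..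
  \<comment> \<open>For \<open>u\<close> outside \<open>L\<close> the default value \<open>0\<close>
    of \<open>column\<close> replaces the case distinction.\<close>
  also have "\<dots> = x new ^ card {k \<in> N. pos k < pos j} *
      (column x L P V w + x new * column x L P V u)"
    using L by (simp add: column_def)
  finally show ?thesis
    using L assms by (auto simp: column_def)
qed

end

lemma above_a: "w \<in> - {a}" "N \<subseteq> - {a}"
proof -
  have "pos a \<le> pos u" using facts(3) u_w by blast
  then show "w \<in> - {a}" "N \<subseteq> - {a}" using u_w by (auto dest: N_pos)
qed

lemmas columns_before = column_before[of UNIV, simplified] column_before[of "- {a}", OF above_a(2,1)]
lemmas columns_after = column_after[of UNIV, simplified] column_after[of "- {a}", OF above_a(2,1)]
lemmas columns_inside = column_inside[of UNIV, simplified] column_inside[of "- {a}", OF above_a(2,1)]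

lemma minor_before:
  assumes "j \<in> V" "j' \<in> V" "pos j \<le> pos u" "pos j' \<le> pos u"
  shows "minor x a (insert new P) (V \<union> N) j j' = minor x a P V j j'"
  using assms above_a by (simp add: minor_def columns_before)

lemma minor_after:
  assumes "j \<in> V" "j' \<in> V" "pos w \<le> pos j" "pos w \<le> pos j'"
  shows "minor x a (insert new P) (V \<union> N) j j' = x new ^ (2 * card N) * minor x a P V j j'"
proof -
  define y where "y = x new ^ card N"
  have "x new ^ (2 * card N) = y * y" by (simp add: y_def mult_2 power_add)
  then show ?thesis
    using assms above_a by (simp add: minor_def columns_after flip: y_def) (simp add: algebra_simps)
qed

text \<open>With \<open>C\<close> for the old columns, both new columns are multiples of
  \<open>C(w) + x new * C(u)\<close>, hence linearly dependent.\<close>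

lemma minor_inside:
  assumes "j \<in> N" "j' \<in> N"
  shows "minor x a (insert new P) (V \<union> N) j j' = 0"
  using assms above_a by (simp add: minor_def columns_inside algebra_simps)

text \<open>No new vertex precedes \<open>j'\<close>, so its column is
  \<open>C(w) + x new * C(u)\<close>, and the second summand is a multiple of the column at
  \<open>u\<close>.\<close>

lemma minor_first:
  assumes "j' \<in> N" "{k \<in> N. pos k < pos j'} = {}"
  shows "minor x a (insert new P) (V \<union> N) u j' = minor x a P V u w"
  using above_a u_w columns_inside[OF assms(1), of x]
  by (simp add: minor_def columns_before assms(2) algebra_simps)

text \<open>The exponent at \<open>j\<close> is \<open>card N - 1\<close>. The summand along
  \<open>C(w)\<close> is killed by the column at \<open>w\<close>, and the other summand supplies
  the missing factor \<open>x new\<close>.\<close>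

lemma minor_last:
  assumes "j \<in> N" "{k \<in> N. pos k < pos j} = N - {j}"
  shows "minor x a (insert new P) (V \<union> N) j w = x new ^ (2 * card N) * minor x a P V u w"
proof -
  define y where "y = x new ^ card (N - {j})"
  have "card N = Suc (card (N - {j}))"
    using assms(1) N by (metis card_Suc_Diff1)
  then have y: "x new ^ card N = x new * y" "x new ^ (2 * card N) = (x new * y) * (x new * y)"
    unfolding y_def mult_2 power_add by simp_all
  show ?thesis
    unfolding y(2) using above_a u_w columns_inside[OF assms(1), of x]
    by (simp add: minor_def columns_after assms(2) y(1) flip: y_def) (simp add: algebra_simps)
qed

text \<open>Two vertices from \<open>j\<close> on keep the ear from being a zig piece; old pieces
  have their vertices in \<open>V\<close>, so the threshold may move to any \<open>j'\<close> that
  cuts \<open>V\<close> at the same place.\<close>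

lemma zig_weight_skip:
  assumes "2 \<le> card (new \<inter> {k. pos j \<le> pos k})" "{k \<in> V. pos j \<le> pos k} = {k \<in> V. pos j' \<le> pos k}"
  shows "zig_weight x (insert new P) j = zig_weight x P j'"
proof -
  have "\<beta> \<inter> {k. pos j \<le> pos k} = \<beta> \<inter> {k. pos j' \<le> pos k}" if "\<beta> \<in> P" for \<beta>
    using facts(5)[OF that] assms(2) by blast
  then have "zig (insert new P) j = zig P j'"
    using assms(1) by (auto simp: zig_def)
  then show ?thesis by (simp add: zig_weight_def)
qed

lemma zig_weight_add:
  assumes "card (new \<inter> {k. pos j \<le> pos k}) \<le> 1"
  shows "zig_weight x (insert new P) j = x new ^ (2 * card N) * zig_weight x P j"
proof -
  have "zig (insert new P) j = insert new (zig P j)"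
    using assms(1) by (auto simp: zig_def)
  moreover have "new \<notin> zig P j" "finite (zig P j)"
    using new_notin facts(4) by (auto simp: zig_def)
  ultimately show ?thesis
    unfolding zig_weight_def by (simp only: prod.insert card_new simp_thms)
qed

text \<open>A boundary side lies before the ear, after it, or on it as its first, last or an inner
  side. The pair \<open>u\<close>, \<open>w\<close> no longer occurs because a vertex of
  \<open>N\<close> separates it.\<close>

lemma consecutive_cases:
  assumes "consecutive (V \<union> N) j j'"
  obtains
    (before) "consecutive V j j'" "pos j' \<le> pos u"
  | (after) "consecutive V j j'" "pos w \<le> pos j"
  | (first) "j = u" "j' \<in> N" "{k \<in> N. pos k < pos j'} = {}"
  | (last) "j \<in> N" "j' = w" "{k \<in> N. pos k < pos j} = N - {j}"
  | (inside) "j \<in> N" "j' \<in> N"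
proof -
  have none: "\<And>k. k \<in> V \<union> N \<Longrightarrow> pos k \<le> pos j \<or> pos j' \<le> pos k"
    and j: "j \<in> V \<union> N" "j' \<in> V \<union> N" "pos j < pos j'"
    using assms consecutiveD[OF assms] by (simp_all add: consecutive_def)
  obtain k where k: "k \<in> N" using N by auto
  consider "j \<in> V" "j' \<in> V" | "j \<in> V" "j' \<in> N" | "j \<in> N" "j' \<in> V" | "j \<in> N" "j' \<in> N"
    using j by auto
  then show thesis
  proof cases
    case 1
    then have "consecutive V j j'" using assms by (auto simp: consecutive_def)
    moreover have "pos j' \<le> pos u \<or> pos w \<le> pos j"
      using V_pos[OF 1(1)] V_pos[OF 1(2)] none[of k] N_pos[OF k] k by auto
    ultimately show thesis using before after by auto
  next
    case 2
    have "pos j = pos u"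
      using V_pos[OF 2(1)] N_pos[OF 2(2)] none[of u] u_w(1) j(3) by auto
    then have "j = u" by simp
    have "{k \<in> N. pos k < pos j'} = {}"
      using none \<open>j = u\<close> by (force dest: N_pos)
    with \<open>j = u\<close> show thesis using first 2 by auto
  next
    case 3
    have "pos j' = pos w"
      using V_pos[OF 3(2)] N_pos[OF 3(1)] none[of w] u_w(2) j(3) by auto
    then have "j' = w" by simp
    have "{k \<in> N. pos k < pos j} = N - {j}"
    proof -
      have "pos k < pos j" if "k \<in> N" "k \<noteq> j" for k
      proof -
        have "pos k \<noteq> pos j" using that by simp
        moreover have "pos k \<le> pos j \<or> pos w \<le> pos k"
          using none[of k] that(1) \<open>j' = w\<close> by blast
        ultimately show ?thesis using N_pos[OF that(1)] by linarith
      qed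
      then show ?thesis by auto
    qed
    with \<open>j' = w\<close> show thesis using last 3 by auto
  next
    case 4
    then show thesis using inside by auto
  qed
qed

lemma sides_new: "{u, w} \<in> polygon_sides new"
proof -
  have "outermost new u w"
    using u_w by (auto simp: outermost_def dest: N_pos)
  then show ?thesis by (auto simp: polygon_sides_def)
qed

lemma sides_new_in_V:
  assumes "e \<in> polygon_sides new" "e \<subseteq> V"
  shows "e = {u, w}"
  using assms disjoint by (auto simp: polygon_sides_def outermost_def consecutive_def)

lemma consecutive_new:
  assumes "consecutive (V \<union> N) j j'" "j \<in> new" "j' \<in> new"
  shows "{j, j'} \<in> polygon_sides new"
  using assms u_w by (auto simp: polygon_sides_def consecutive_def)

lemma not_side_old: "\<beta> \<in> P \<Longrightarrow> k \<in> N \<Longrightarrow> k \<in> f \<Longrightarrow> f \<notin> polygon_sides \<beta>"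
  using polygon_sides_subset pieces_disjoint by blast

end

context vertex_order
begin

lemma ear_glue:
  assumes "ear_built a b V E P" "consecutive V u w" "finite N" "N \<noteq> {}" "N \<subseteq> between u w"
  shows "ear pos a b V E P u w N"
  using assms by unfold_locales

text \<open>A side at a new vertex belongs to no old piece, and a side within \<open>V\<close>
  belongs to the ear only if it is the base, which has left the boundary. Applied to the base of the
  next ear, this keeps a zig-zag sequence from using that base between two old pieces.\<close>

lemma side_unique:
  assumes "ear_built a b V E P" "consecutive V s t" "\<beta> \<in> P" "\<gamma> \<in> P"
    "{s, t} \<in> polygon_sides \<beta>" "{s, t} \<in> polygon_sides \<gamma>"
  shows "\<beta> = \<gamma>"
  using assms
proof (induction arbitrary: s t \<beta> \<gamma>)
  case (glue V E P u w N)
  interpret ear pos a b V E P u w N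
    using glue.hyps by (rule ear_glue)
  have old: "\<beta> = \<gamma>" if "consecutive V s t" "s \<noteq> u"
  proof -
    have "{s, t} \<subseteq> V" "{s, t} \<noteq> {u, w}"
      using that u_w by (auto simp: consecutive_def doubleton_eq_iff)
    then have "{s, t} \<notin> polygon_sides new" using sides_new_in_V by blast
    then show ?thesis using glue.prems glue.IH[OF that(1)] by blast
  qed
  have ear: "\<beta> = \<gamma>" if "k \<in> N" "k \<in> {s, t}" for k
    using glue.prems not_side_old[OF _ that] by blast
  have "s \<noteq> u" if "pos w \<le> pos s \<or> consecutive V s t \<and> pos t \<le> pos u"
    using that u_w by (auto simp: consecutive_def)
  with glue.prems(1) old ear show ?case
    by (elim consecutive_cases; blast)
qed simp

lemma zigzag_via_at:
  assumes "zigzag_via D P e f zs ps" "k < length ps"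
  shows "ps ! k \<in> P" "zs ! k \<in> polygon_sides (ps ! k)" "zs ! Suc k \<in> polygon_sides (ps ! k)"
    "zs ! k \<inter> zs ! Suc k \<noteq> {}" "0 < k \<Longrightarrow> zs ! k \<in> D" "Suc k < length ps \<Longrightarrow> zs ! Suc k \<in> D"
    "l < length ps \<Longrightarrow> ps ! k = ps ! l \<longleftrightarrow> k = l"
  using assms by (auto simp: zigzag_via_def nth_eq_iff_index_eq dest: nth_mem)

end

section \<open>Zig-zag sequences before and after glueing an ear\<close>

context ear
begin

lemma uw_side_unique:
  "\<beta> \<in> P \<Longrightarrow> \<gamma> \<in> P \<Longrightarrow> {u, w} \<in> polygon_sides \<beta> \<Longrightarrow> {u, w} \<in> polygon_sides \<gamma> \<Longrightarrow> \<beta> = \<gamma>"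
  using side_unique[OF built uw] .

text \<open>A sequence using the ear would enter and leave it through the base, its only side within
  \<open>V\<close>. Both neighbouring pieces would be old with the base as a side, hence equal,
  against distinctness. For a similar reason the base is no member of the sequence.\<close>

lemma zigzag_old:
  assumes f: "f \<subseteq> V" "f \<noteq> {u, w}" "{a, b} \<noteq> {u, w}"
  shows "zigzag (insert {u, w} E - {{a, b}}) (insert new P) {a, b} f \<longleftrightarrow> zigzag (E - {{a, b}}) P {a, b} f"
proof
  assume "zigzag (insert {u, w} E - {{a, b}}) (insert new P) {a, b} f"
  then obtain zs ps where z: "zigzag_via (insert {u, w} E - {{a, b}}) (insert new P) {a, b} f zs ps"
    by (auto simp: zigzag_def)
  note at = zigzag_via_at[OF z]
  have ends: "zs ! 0 = {a, b}" "zs ! length ps = f"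
    using z by (auto simp: zigzag_via_def)
  have ab: "{a, b} \<subseteq> V"
    using ear_built_facts[OF built] by blast
  have zV: "zs ! k \<subseteq> V" if "k \<le> length ps" for k
  proof (cases "k = 0 \<or> k = length ps")
    case True
    then show ?thesis using ends ab f(1) by auto
  next
    case False
    then have "zs ! k \<in> insert {u, w} E" using at(5)[of k] that by auto
    then show ?thesis using facts(6) u_w by auto
  qed
  have old: "ps ! k \<noteq> new" if "k < length ps" for k
  proof
    assume new: "ps ! k = new"
    then have uw: "zs ! k = {u, w}" "zs ! Suc k = {u, w}"
      using at(2,3)[OF that] zV[of k] zV[of "Suc k"] that unfolding new
      by (intro sides_new_in_V; simp)+
    \<comment> \<open>The base is neither the first nor the last member, so there are pieces before
      and after the ear.\<close>
    then have k: "0 < k" "Suc k < length ps"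
      using ends f that by (metis gr0I, metis Suc_lessI)
    then obtain m where m: "k = Suc m" by (cases k) auto
    have ne: "ps ! m \<noteq> new" "ps ! Suc k \<noteq> new" "ps ! m \<noteq> ps ! Suc k"
      using at(7)[OF that, of m] at(7)[OF that, of "Suc k"] at(7)[of m "Suc k"] k m new by auto
    have "ps ! m \<in> P" "ps ! Suc k \<in> P"
      using at(1)[of m] at(1)[of "Suc k"] ne k m by auto
    moreover have "{u, w} \<in> polygon_sides (ps ! m)" "{u, w} \<in> polygon_sides (ps ! Suc k)"
      using at(3)[of m] at(2)[of "Suc k"] uw k m by auto
    ultimately show False using uw_side_unique ne(3) by blast
  qed
  have P: "ps ! k \<in> P" if "k < length ps" for k
    using at(1)[OF that] old[OF that] by blast
  have "zs ! k \<in> E - {{a, b}}" if k: "0 < k" "k < length ps" for k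
  proof -
    obtain m where m: "k = Suc m" using k by (cases k) auto
    have "zs ! k \<noteq> {u, w}"
    proof
      assume "zs ! k = {u, w}"
      then have "ps ! m = ps ! k"
        using at(3)[of m] at(2)[of k] k m P by (intro uw_side_unique) auto
      then show False using at(7)[of m k] k m by auto
    qed
    then show ?thesis using at(5)[of k] k by blast
  qed
  moreover have "set ps \<subseteq> P" using P by (auto simp: in_set_conv_nth)
  ultimately have "zigzag_via (E - {{a, b}}) P {a, b} f zs ps"
    using z by (simp add: zigzag_via_def)
  then show "zigzag (E - {{a, b}}) P {a, b} f" by (auto simp: zigzag_def)
next
  assume "zigzag (E - {{a, b}}) P {a, b} f"
  then show "zigzag (insert {u, w} E - {{a, b}}) (insert new P) {a, b} f"
    by (rule zigzag_mono) auto
qed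

text \<open>An edge at a new vertex belongs to no old piece, so the last piece is the ear, which can
  only have been entered through its base. Dropping or appending the ear relates the two kinds of
  sequences.\<close>

lemma zigzag_new:
  assumes f: "f \<in> polygon_sides new" "f \<inter> N \<noteq> {}"
  shows "zigzag (insert {u, w} E - {{a, b}}) (insert new P) {a, b} f \<longleftrightarrow>
    f \<inter> {u, w} \<noteq> {} \<and> zigzag (E - {{a, b}}) P {a, b} {u, w}"
proof
  assume "zigzag (insert {u, w} E - {{a, b}}) (insert new P) {a, b} f"
  then obtain zs ps where z: "zigzag_via (insert {u, w} E - {{a, b}}) (insert new P) {a, b} f zs ps"
    by (auto simp: zigzag_def)
  note at = zigzag_via_at[OF z]
  have ends: "zs ! 0 = {a, b}" "zs ! length ps = f"
    using z by (auto simp: zigzag_via_def)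
  have ab: "{a, b} \<subseteq> V"
    using ear_built_facts[OF built] by blast
  obtain s where s: "length ps = Suc s"
    using ends ab f disjoint by (cases "length ps") auto
  have new: "ps ! s = new"
    using at(1,3)[of s] s ends f not_side_old by (metis disjoint_iff insertE lessI)
  have "zs ! s \<subseteq> V"
  proof (cases "s = 0")
    case True
    then show ?thesis using ends ab by simp
  next
    case False
    then have "zs ! s \<in> insert {u, w} E" using at(5)[of s] s by auto
    then show ?thesis using facts(6) u_w by auto
  qed
  then have uw: "zs ! s = {u, w}"
    using at(2)[of s] s new sides_new_in_V by auto
  have P: "ps ! k \<in> P" if "k < s" for k
    using at(1)[of k] at(7)[of k s] that new s by auto
  have "zs ! k \<in> E - {{a, b}}" if k: "0 < k" "k < s" for k
  proof -
    obtain m where m: "k = Suc m" using k by (cases k) auto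
    have "zs ! k \<noteq> {u, w}"
    proof
      assume "zs ! k = {u, w}"
      then have "ps ! m = ps ! k"
        using at(3)[of m] at(2)[of k] k m s P by (intro uw_side_unique) auto
      then show False using at(7)[of m k] k m s by auto
    qed
    then show ?thesis using at(5)[of k] k s by auto
  qed
  moreover have "set (take s ps) \<subseteq> P" using P s by (auto simp: in_set_conv_nth)
  ultimately have "zigzag_via (E - {{a, b}}) P {a, b} {u, w} (take (Suc s) zs) (take s ps)"
    using z s uw by (simp add: zigzag_via_def)
  moreover have "f \<inter> {u, w} \<noteq> {}"
    using at(4)[of s] uw ends s by auto
  ultimately show "f \<inter> {u, w} \<noteq> {} \<and> zigzag (E - {{a, b}}) P {a, b} {u, w}"
    by (auto simp: zigzag_def)
next
  assume r: "f \<inter> {u, w} \<noteq> {} \<and> zigzag (E - {{a, b}}) P {a, b} {u, w}"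
  then obtain zs ps where z: "zigzag_via (E - {{a, b}}) P {a, b} {u, w} zs ps"
    by (auto simp: zigzag_def)
  have len: "length zs = Suc (length ps)" "zs ! length ps = {u, w}" "set ps \<subseteq> P"
    using z by (auto simp: zigzag_via_def)
  \<comment> \<open>The base becomes an inner member of the extended sequence unless it is also the
    first one, so it must differ from the root. If it is the root, only the digon has been built and
    there are no pieces.\<close>
  have ne: "{u, w} \<noteq> {a, b}" if "ps \<noteq> []"
  proof
    assume "{u, w} = {a, b}"
    then have "u = a" "w = b"
      using ear_built_facts[OF built] u_w by (auto simp: doubleton_eq_iff)
    then have "between a b \<inter> V = {}" using uw by (simp add: consecutive_def)
    then show False using ear_built_facts[OF built] that len(3) by auto
  qed
  have "zigzag_via (insert {u, w} E - {{a, b}}) (insert new P) {a, b} f (zs @ [f]) (ps @ [new])"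
    using z r len ne f sides_new new_notin
    by (auto simp: zigzag_via_def nth_append less_Suc_eq)
  then show "zigzag (insert {u, w} E - {{a, b}}) (insert new P) {a, b} f"
    by (auto simp: zigzag_def)
qed

end

section \<open>Minors and columns by induction on the ears\<close>

context vertex_order
begin

text \<open>The columns of the digon are unit vectors; the entry of row \<open>b\<close> at
  \<open>b\<close> vanishes because \<open>a\<close> would need a piece.\<close>

lemma digon_columns:
  assumes "pos a < pos b"
  shows "column x UNIV {} {a, b} a = 1" "column x UNIV {} {a, b} b = 0"
    "column x (- {a}) {} {a, b} a = 0" "column x (- {a}) {} {a, b} b = 1"
proof -
  have sets: "{k \<in> {a, b} \<inter> UNIV. pos k < pos a} = {}" "{k \<in> {a, b} \<inter> UNIV. pos k < pos b} = {a}"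
    "{k \<in> {a, b} \<inter> - {a}. pos k < pos b} = {}"
    using assms by auto
  show "column x UNIV {} {a, b} a = 1" "column x UNIV {} {a, b} b = 0"
    "column x (- {a}) {} {a, b} a = 0" "column x (- {a}) {} {a, b} b = 1"
    using assms by (auto simp only: column_def sets assignment_sum_empty assignment_sum_uncovered[of a "{a}" "{}"])
      (auto simp: assignment_sum_uncovered)
qed

text \<open>In each case of \<open>consecutive_cases\<close> the minor, the zig weight and the
  existence of a zig-zag sequence change in step; at inner sides of an ear the minor vanishes and no
  sequence exists.\<close>

lemma ear_built_minor:
  fixes x :: "'v set \<Rightarrow> 'a::comm_ring_1"
  assumes "ear_built a b V E P" "consecutive V j j'"
  shows "minor x a P V j j' =
    (if zigzag (E - {{a, b}}) P {a, b} {j, j'} then zig_weight x P j' else 0)"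
  using assms
proof (induction arbitrary: j j')
  case digon
  have j: "j = a" "j' = b"
    using digon by (auto simp: consecutive_def)
  have "minor x a {} {a, b} a b = 1"
    using digon_columns[OF digon(1), of x] by (simp add: minor_def)
  then show ?case
    unfolding j by (simp add: zigzag_refl zig_weight_def zig_def)
next
  case (glue V E P u w N)
  interpret ear pos a b V E P u w N
    using glue.hyps by (rule ear_glue)
  have ab: "\<forall>k\<in>V. pos a \<le> pos k \<and> pos k \<le> pos b" "a \<in> V" "b \<in> V"
    using ear_built_facts[OF built] by auto
  note IH_uw = glue.IH[OF uw]
  show ?case
    using glue.prems
  proof (cases rule: consecutive_cases)
    case before
    then have j: "j \<in> V" "j' \<in> V" "pos j < pos j'" by (auto simp: consecutive_def)
    \<comment> \<open>Both \<open>u\<close> and \<open>w\<close> lie from \<open>j'\<close> on, so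
      the ear is no zig piece.\<close>
    have "2 \<le> card {u, w}" using u_w by simp
    also have "\<dots> \<le> card (new \<inter> {k. pos j' \<le> pos k})"
      using before u_w N by (intro card_mono) auto
    finally have "zig_weight x (insert new P) j' = zig_weight x P j'"
      by (rule zig_weight_skip) simp
    moreover have "{a, b} \<noteq> {u, w}"
      using before j u_w ab by (auto simp: doubleton_eq_iff)
    moreover have "{j, j'} \<noteq> {u, w}"
      using before j u_w by (auto simp: doubleton_eq_iff)
    ultimately show ?thesis
      using zigzag_old[of "{j, j'}"] glue.IH[OF before(1)] minor_before[of j j' x] j before by simp
  next
    case after
    then have j: "j \<in> V" "j' \<in> V" "pos j < pos j'" by (auto simp: consecutive_def)
    have "new \<inter> {k. pos j' \<le> pos k} = {}"
      using after j u_w N_pos by force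
    then have "zig_weight x (insert new P) j' = x new ^ (2 * card N) * zig_weight x P j'"
      by (intro zig_weight_add) simp
    moreover have "{a, b} \<noteq> {u, w}"
      using after j u_w ab by (auto simp: doubleton_eq_iff)
    moreover have "{j, j'} \<noteq> {u, w}"
      using after j u_w by (auto simp: doubleton_eq_iff)
    ultimately show ?thesis
      using zigzag_old[of "{j, j'}"] glue.IH[OF after(1)] minor_after[of j j' x] j after by simp
  next
    case first
    have "pos j' < pos w" "pos u < pos j'" using N_pos first by auto
    have "j' \<noteq> w" using first u_w_notin_N by blast
    \<comment> \<open>The ear has two vertices from \<open>j'\<close> on; as no old vertex lies
      between \<open>j'\<close> and \<open>w\<close>, the threshold for the old pieces is that of
      the base.\<close>
    then have "2 \<le> card {j', w}" by simp
    also have "\<dots> \<le> card (new \<inter> {k. pos j' \<le> pos k})"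
      using first N \<open>pos j' < pos w\<close> by (intro card_mono) auto
    finally have "zig_weight x (insert new P) j' = zig_weight x P w"
      using V_pos \<open>pos j' < pos w\<close> \<open>pos u < pos j'\<close> by (intro zig_weight_skip) force+
    moreover have "{j, j'} \<in> polygon_sides new"
      using glue.prems first by (intro consecutive_new) auto
    ultimately show ?thesis
      using zigzag_new[of "{j, j'}"] IH_uw first minor_first[of j' x] by simp
  next
    case last
    \<comment> \<open>One vertex from \<open>j'\<close> on is allowed for a zig piece, so the ear is
      one.\<close>
    have "new \<inter> {k. pos j' \<le> pos k} = {w}"
      using last u_w N_pos by force
    then have "zig_weight x (insert new P) j' = x new ^ (2 * card N) * zig_weight x P w"
      using last by (simp add: zig_weight_add)
    moreover have "{j, j'} \<in> polygon_sides new"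
      using glue.prems last by (intro consecutive_new) auto
    ultimately show ?thesis
      using zigzag_new[of "{j, j'}"] IH_uw last minor_last[of j x] by simp
  next
    case inside
    have "{j, j'} \<in> polygon_sides new"
      using glue.prems inside by (intro consecutive_new) auto
    moreover have "{j, j'} \<inter> {u, w} = {}"
      using inside u_w_notin_N by auto
    ultimately show ?thesis
      using zigzag_new[of "{j, j'}"] inside minor_inside[of j j' x] by simp
  qed
qed

text \<open>The uses \<open>card \<alpha> - 2\<close> add up to \<open>card V - 2\<close>. Row
  \<open>b\<close> asks for the \<open>card V - 1\<close> vertices other than \<open>b\<close>,
  which is too many; row \<open>a\<close> asks for one less and exhausts every piece. In the
  induction, \<open>b\<close> lies after each ear, which therefore contributes a factor.\<close>

lemma ear_built_column:
  fixes x :: "'v set \<Rightarrow> 'a::comm_ring_1"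
  assumes "ear_built a b V E P"
  shows "column x UNIV P V b = 0"
    and "column x (- {a}) P V b = (\<Prod>\<alpha>\<in>P. x \<alpha> ^ (card \<alpha> - 2))"
  using assms
proof induction
  case digon
  then show "column x UNIV {} {a, b} b = 0"
    "column x (- {a}) {} {a, b} b = (\<Prod>\<alpha>\<in>{}. x \<alpha> ^ (card \<alpha> - 2))"
    using digon_columns[of a b x] by simp_all
next
  case (glue V E P u w N)
  interpret ear pos a b V E P u w N
    using glue.hyps by (rule ear_glue)
  have b: "b \<in> V" "pos w \<le> pos b"
    using ear_built_facts[OF built] u_w by auto
  show "column x UNIV (insert new P) (V \<union> N) b = 0"
    using glue.IH columns_after(1)[OF b, of x] by simp
  show "column x (- {a}) (insert new P) (V \<union> N) b = (\<Prod>\<alpha>\<in>insert new P. x \<alpha> ^ (card \<alpha> - 2))"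
    using glue.IH columns_after(2)[OF b, of x] new_notin facts(4)
    by (simp only: prod.insert card_new simp_thms)
qed

end

section \<open>A shortest chord cuts off an ear\<close>

context vertex_order
begin

lemma ex_highest:
  assumes "finite X" "X \<noteq> {}"
  obtains m where "m \<in> X" "\<And>y. y \<in> X \<Longrightarrow> pos y \<le> pos m"
proof -
  have "Max (pos ` X) \<in> pos ` X" using assms by simp
  then obtain m where m: "m \<in> X" "pos m = Max (pos ` X)" by auto
  show thesis
    by (rule that[of m]) (use m assms in simp_all)
qed

lemma ex_lowest:
  assumes "finite X" "X \<noteq> {}"
  obtains m where "m \<in> X" "\<And>y. y \<in> X \<Longrightarrow> pos m \<le> pos y"
proof -
  have "Min (pos ` X) \<in> pos ` X" using assms by simp
  then obtain m where m: "m \<in> X" "pos m = Min (pos ` X)" by auto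
  show thesis
    by (rule that[of m]) (use m assms in simp_all)
qed

lemma consecutiveI:
  "s \<in> S \<Longrightarrow> t \<in> S \<Longrightarrow> pos s < pos t \<Longrightarrow> (\<And>k. k \<in> S \<Longrightarrow> pos s < pos k \<Longrightarrow> pos t \<le> pos k) \<Longrightarrow>
    consecutive S s t"
  by (fastforce simp: consecutive_def between_def disjoint_iff)

lemma ex_next:
  assumes "finite S" "k \<in> S" "y \<in> S" "pos k < pos y"
  obtains t where "consecutive S k t"
proof -
  have "finite {y \<in> S. pos k < pos y}" "{y \<in> S. pos k < pos y} \<noteq> {}" using assms by auto
  then obtain t where t: "t \<in> {y \<in> S. pos k < pos y}"
    "\<And>y. y \<in> {y \<in> S. pos k < pos y} \<Longrightarrow> pos t \<le> pos y"
    by (rule ex_lowest) blast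
  have "consecutive S k t"
    using t assms(2) by (intro consecutiveI) auto
  then show thesis by (rule that)
qed

lemma ex_previous:
  assumes "finite S" "k \<in> S" "y \<in> S" "pos y < pos k"
  obtains t where "consecutive S t k"
proof -
  have "finite {y \<in> S. pos y < pos k}" "{y \<in> S. pos y < pos k} \<noteq> {}" using assms by auto
  then obtain t where t: "t \<in> {y \<in> S. pos y < pos k}"
    "\<And>y. y \<in> {y \<in> S. pos y < pos k} \<Longrightarrow> pos y \<le> pos t"
    by (rule ex_highest) blast
  have "consecutive S t k"
  proof (rule consecutiveI)
    fix y assume "y \<in> S" "pos t < pos y"
    then show "pos k \<le> pos y" using t(2)[of y] by (auto simp: not_less[symmetric])
  qed (use t assms(2) in auto)
  then show thesis by (rule that)
qed

lemma ordered_doubleton_eq: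
  "pos s < pos t \<Longrightarrow> pos s' < pos t' \<Longrightarrow> {s, t} = {s', t'} \<longleftrightarrow> s = s' \<and> t = t'"
  by (auto simp: doubleton_eq_iff)

text \<open>The root counts as a chord while any vertex lies between \<open>a\<close> and
  \<open>b\<close>. So every ear has a chord as its base, and without chords only the digon is
  left.\<close>

definition chord_system :: "'v \<Rightarrow> 'v \<Rightarrow> 'v set \<Rightarrow> 'v set set \<Rightarrow> bool" where
  "chord_system a b V E \<longleftrightarrow>
     finite V \<and> a \<in> V \<and> b \<in> V \<and> pos a < pos b \<and> (\<forall>k\<in>V. pos a \<le> pos k \<and> pos k \<le> pos b) \<and>
     (\<forall>e\<in>E. \<exists>s\<in>V. \<exists>t\<in>V. e = {s, t} \<and> pos s < pos t \<and> between s t \<inter> V \<noteq> {}) \<and>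
     (\<forall>p q r s. {p, r} \<in> E \<longrightarrow> {q, s} \<in> E \<longrightarrow>
        \<not> (pos p < pos q \<and> pos q < pos r \<and> pos r < pos s)) \<and>
     (between a b \<inter> V \<noteq> {} \<longrightarrow> {a, b} \<in> E)"

definition polygon_pieces :: "'v set \<Rightarrow> 'v set set \<Rightarrow> 'v set set" where
  "polygon_pieces V E = {S. S \<subseteq> V \<and> 3 \<le> card S \<and>
     (\<forall>e\<in>polygon_sides S. e \<in> E \<or> (\<exists>s t. e = {s, t} \<and> consecutive V s t)) \<and>
     (\<forall>e\<in>E. e \<subseteq> S \<longrightarrow> e \<in> polygon_sides S)}"

end

section \<open>Removing the ear under a shortest chord\<close>

locale shortest_chord = vertex_order pos for pos :: "'v \<Rightarrow> nat" +
  fixes a b :: 'v and V E u w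
  assumes chords: "chord_system a b V E"
    and uw: "{u, w} \<in> E" "pos u < pos w"
    and shortest: "{s, t} \<in> E \<Longrightarrow> pos s < pos t \<Longrightarrow> pos w - pos u \<le> pos t - pos s"
begin

abbreviation N where "N \<equiv> between u w \<inter> V"
abbreviation V' where "V' \<equiv> V - N"
abbreviation E' where "E' \<equiv> E - {{u, w}}"
abbreviation new where "new \<equiv> insert u (insert w N)"

lemma finite_V: "finite V" using chords by (simp add: chord_system_def)

lemma chordE:
  assumes "e \<in> E"
  obtains s t k where "e = {s, t}" "s \<in> V" "t \<in> V" "pos s < pos t" "k \<in> V" "pos s < pos k" "pos k < pos t"
proof -
  have "\<exists>s\<in>V. \<exists>t\<in>V. e = {s, t} \<and> pos s < pos t \<and> between s t \<inter> V \<noteq> {}"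
    using chords assms by (simp add: chord_system_def)
  then obtain s t where "s \<in> V" "t \<in> V" "e = {s, t}" "pos s < pos t" "between s t \<inter> V \<noteq> {}"
    by blast
  moreover from this obtain k where "k \<in> V" "pos s < pos k" "pos k < pos t"
    by (auto simp: between_def)
  ultimately show thesis by (intro that[of s t k])
qed

lemma noncrossing:
  "{p, r} \<in> E \<Longrightarrow> {q, s} \<in> E \<Longrightarrow> pos p < pos q \<Longrightarrow> pos q < pos r \<Longrightarrow> pos r < pos s \<Longrightarrow> False"
  using chords by (simp add: chord_system_def)

lemma u_w: "u \<in> V" "w \<in> V" "u \<noteq> w" "N \<noteq> {}" "u \<in> V'" "w \<in> V'"
proof -
  obtain s t k where st: "{u, w} = {s, t}" "s \<in> V" "t \<in> V" "pos s < pos t"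
    "k \<in> V" "pos s < pos k" "pos k < pos t"
    by (rule chordE[OF uw(1)])
  then have "s = u" "t = w" using ordered_doubleton_eq[OF uw(2) st(4)] by auto
  then show "u \<in> V" "w \<in> V" "u \<noteq> w" "N \<noteq> {}" "u \<in> V'" "w \<in> V'"
    using st by (auto simp: between_def)
qed

lemma N_iff: "k \<in> N \<longleftrightarrow> k \<in> V \<and> pos u < pos k \<and> pos k < pos w"
  by (auto simp: between_def)

lemma V'_pos: "k \<in> V' \<Longrightarrow> pos k \<le> pos u \<or> pos w \<le> pos k"
  by (auto simp: between_def)

text \<open>A chord ending strictly between \<open>u\<close> and \<open>w\<close> either stays under
  the chord from \<open>u\<close> to \<open>w\<close> and is shorter, or leaves and crosses
  it.\<close>

lemma chord_outside:
  assumes st: "{s, t} \<in> E" "pos s < pos t"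
  shows "s \<notin> N" "t \<notin> N"
proof -
  show "s \<notin> N"
  proof
    assume s: "s \<in> N"
    show False
    proof (cases "pos t \<le> pos w")
      case True
      then show False using shortest[OF st] s st(2) by (auto simp: between_def)
    next
      case False
      then show False using noncrossing[OF uw(1) st(1)] s by (auto simp: between_def)
    qed
  qed
  show "t \<notin> N"
  proof
    assume t: "t \<in> N"
    show False
    proof (cases "pos u \<le> pos s")
      case True
      then show False using shortest[OF st] t st(2) by (auto simp: between_def)
    next
      case False
      then show False using noncrossing[OF st(1) uw(1)] t by (auto simp: between_def)
    qed
  qed
qed

lemma chord_subset:
  assumes "e \<in> E"
  shows "e \<subseteq> V'"
proof -
  obtain s t where "e = {s, t}" "s \<in> V" "t \<in> V" "pos s < pos t"
    by (rule chordE[OF assms])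
  then show ?thesis using chord_outside[of s t] assms by auto
qed

text \<open>Only removed vertices can separate neighbours in \<open>V'\<close>, and all of these lie
  between \<open>u\<close> and \<open>w\<close>.\<close>

lemma consecutive_V':
  assumes "s \<in> V'" "t \<in> V'"
  shows "consecutive V' s t \<longleftrightarrow> consecutive V s t \<or> s = u \<and> t = w"
proof
  assume st: "consecutive V' s t"
  show "consecutive V s t \<or> s = u \<and> t = w"
  proof (cases "consecutive V s t")
    case False
    then obtain k where k: "k \<in> V" "pos s < pos k" "pos k < pos t"
      using st by (auto simp: consecutive_def between_def)
    then have kN: "pos u < pos k" "pos k < pos w"
      using consecutiveD[OF st, of k] N_iff[of k] by auto
    have "pos s \<le> pos u" "pos w \<le> pos t"
      using V'_pos[OF assms(1)] V'_pos[OF assms(2)] k kN by auto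
    moreover have "pos u \<le> pos s \<or> pos t \<le> pos u" "pos w \<le> pos s \<or> pos t \<le> pos w"
      using consecutiveD[OF st u_w(5)] consecutiveD[OF st u_w(6)] by auto
    ultimately have "pos s = pos u" "pos t = pos w" using uw(2) k kN by linarith+
    then show ?thesis by simp
  qed simp
next
  assume "consecutive V s t \<or> s = u \<and> t = w"
  then show "consecutive V' s t"
    using assms uw(2) by (auto simp: consecutive_def)
qed

lemma new_piece: "new \<in> polygon_pieces V E"
proof -
  have "new \<subseteq> V" using u_w by auto
  have fin: "finite N" using finite_V by simp
  then have "card new = 2 + card N" "card N > 0"
    using u_w by (simp_all add: card_gt_0_iff)
  then have "3 \<le> card new" by simp
  moreover have "e \<in> E \<or> (\<exists>s t. e = {s, t} \<and> consecutive V s t)" if "e \<in> polygon_sides new" for e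
  proof -
    obtain s t where e: "e = {s, t}" and st: "consecutive new s t \<or> outermost new s t"
      using \<open>e \<in> polygon_sides new\<close> unfolding polygon_sides_def by blast
    from st show ?thesis
    proof
      assume st: "consecutive new s t"
      then have st': "pos u \<le> pos s" "pos t \<le> pos w" "s \<in> V" "t \<in> V" "pos s < pos t"
        using uw(2) u_w by (auto simp: consecutive_def between_def)
      have "pos t \<le> pos k" if "k \<in> V" "pos s < pos k" for k
      proof (cases "pos k < pos w")
        case True
        then have "k \<in> N" using that st'(1) by (simp add: between_def)
        then show ?thesis using consecutiveD[OF st, of k] that(2) by simp
      qed (use st'(2) in simp)
      then have "consecutive V s t"
        using st' by (intro consecutiveI) auto
      then show ?thesis using e by blast
    next
      assume st: "outermost new s t"
      then have "pos s \<le> pos u" "pos w \<le> pos t" "s \<in> new" "t \<in> new" by (auto simp: outermost_def)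
      then have "s = u" "t = w" using uw(2) by (auto simp: between_def)
      then show ?thesis using e uw(1) by simp
    qed
  qed
  moreover have "e \<in> polygon_sides new" if e: "e \<in> E" "e \<subseteq> new" for e
  proof -
    obtain s t where st: "e = {s, t}" "pos s < pos t"
      by (rule chordE[OF e(1)])
    \<comment> \<open>Chords have no end in \<open>N\<close>, so the base is the only chord with
      both ends on the ear.\<close>
    have "s \<in> {u, w}" "t \<in> {u, w}"
      using chord_subset[OF e(1)] e(2) st by auto
    then have "e = {u, w}" using st by auto
    moreover have "outermost new u w" using uw(2) by (auto simp: outermost_def between_def)
    ultimately show ?thesis unfolding polygon_sides_def by blast
  qed
  ultimately show ?thesis
    using \<open>new \<subseteq> V\<close> unfolding polygon_pieces_def by blast
qed

text \<open>Without \<open>N\<close> the pair \<open>u\<close>, \<open>w\<close> turns from a chord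
  into a consecutive pair, so the admissible sides stay the same. If \<open>S\<close> contains the
  pair, it is a side of \<open>S\<close> anyway, so the condition on chords is unaffected.\<close>

lemma old_piece:
  assumes "S \<subseteq> V'"
  shows "S \<in> polygon_pieces V E \<longleftrightarrow> S \<in> polygon_pieces V' E'"
proof -
  have "(e \<in> E \<or> (\<exists>s t. e = {s, t} \<and> consecutive V s t)) \<longleftrightarrow>
      (e \<in> E' \<or> (\<exists>s t. e = {s, t} \<and> consecutive V' s t))" if "e \<subseteq> V'" for e
  proof -
    have "e = {s, t} \<and> consecutive V' s t \<longleftrightarrow> e = {s, t} \<and> (consecutive V s t \<or> s = u \<and> t = w)" for s t
      using consecutive_V'[of s t] that by blast
    then show ?thesis using uw(1) by simp blast
  qed
  then have "(e \<in> E \<or> (\<exists>s t. e = {s, t} \<and> consecutive V s t)) \<longleftrightarrow>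
      (e \<in> E' \<or> (\<exists>s t. e = {s, t} \<and> consecutive V' s t))" if "e \<in> polygon_sides S" for e
    using subset_trans[OF polygon_sides_subset[OF that] assms] .
  then have sides: "(\<forall>e\<in>polygon_sides S. e \<in> E \<or> (\<exists>s t. e = {s, t} \<and> consecutive V s t)) \<longleftrightarrow>
      (\<forall>e\<in>polygon_sides S. e \<in> E' \<or> (\<exists>s t. e = {s, t} \<and> consecutive V' s t))"
    by (intro ball_cong refl)
  have "{u, w} \<in> polygon_sides S" if "{u, w} \<subseteq> S"
  proof -
    have "consecutive S u w"
      using that assms uw(2) by (auto simp: consecutive_def)
    then show ?thesis unfolding polygon_sides_def by blast
  qed
  then have "(\<forall>e\<in>E. e \<subseteq> S \<longrightarrow> e \<in> polygon_sides S) \<longleftrightarrow> (\<forall>e\<in>E'. e \<subseteq> S \<longrightarrow> e \<in> polygon_sides S)"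
    by blast
  moreover have "S \<subseteq> V" using assms by blast
  ultimately show ?thesis
    using assms sides by (simp only: polygon_pieces_def mem_Collect_eq simp_thms)
qed

text \<open>A side at a vertex cut off by a shortest chord is a boundary side, so a piece having such a
  vertex contains its neighbours and hence the whole ear.\<close>

lemma piece_at_N:
  assumes S: "S \<in> polygon_pieces V E" and k: "k \<in> S" "k \<in> N"
  shows "S = new"
proof -
  have SV: "S \<subseteq> V" and card: "3 \<le> card S"
    and sides: "\<And>e. e \<in> polygon_sides S \<Longrightarrow> e \<in> E \<or> (\<exists>s t. e = {s, t} \<and> consecutive V s t)"
    and chords': "\<And>e. e \<in> E \<Longrightarrow> e \<subseteq> S \<Longrightarrow> e \<in> polygon_sides S"
    using S unfolding polygon_pieces_def by blast+
  have fin: "finite S" using finite_V SV by (rule rev_finite_subset)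
  have side: "consecutive V s t"
    if st: "{s, t} \<in> polygon_sides S" "pos s < pos t" "s \<in> N \<or> t \<in> N" for s t
  proof -
    have "{s, t} \<notin> E" using chord_outside st by blast
    then obtain s' t' where "{s, t} = {s', t'}" "consecutive V s' t'"
      using sides[OF st(1)] by blast
    moreover from this have "s = s'" "t = t'"
      using ordered_doubleton_eq[OF st(2), of s' t'] by (auto simp: consecutive_def)
    ultimately show ?thesis by simp
  qed
  \<comment> \<open>Otherwise this side is a boundary side, and \<open>S\<close> has nothing between
    its first and last vertex, against \<open>3 \<le> card S\<close>.\<close>
  have not_outer: "s \<notin> N \<and> t \<notin> N" if "outermost S s t" for s t
  proof (rule ccontr)
    assume "\<not> ?thesis"
    moreover have "{s, t} \<in> polygon_sides S" "pos s < pos t"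
      using that by (auto simp: polygon_sides_def outermost_def)
    ultimately have "consecutive V s t" using side by blast
    have "S \<subseteq> {s, t}"
    proof
      fix y assume "y \<in> S"
      then have "pos s \<le> pos y" "pos y \<le> pos t" "pos y \<le> pos s \<or> pos t \<le> pos y"
        using that SV consecutiveD[OF \<open>consecutive V s t\<close>, of y] by (auto simp: outermost_def)
      then have "pos y = pos s \<or> pos y = pos t" by linarith
      then show "y \<in> {s, t}" by simp
    qed
    then have "card S \<le> card {s, t}" by (intro card_mono) auto
    also have "\<dots> \<le> 2" by (simp add: card_insert_if)
    finally show False using card by simp
  qed
  obtain s0 where s0: "s0 \<in> S" "\<And>y. y \<in> S \<Longrightarrow> pos s0 \<le> pos y"
    using ex_lowest[of S] fin k(1) by blast
  obtain t0 where t0: "t0 \<in> S" "\<And>y. y \<in> S \<Longrightarrow> pos y \<le> pos t0"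
    using ex_highest[of S] fin k(1) by blast
  have "s0 \<noteq> t0"
  proof
    assume "s0 = t0"
    then have "S \<subseteq> {s0}" using s0 t0 by (metis antisym pos_eq singletonI subsetI)
    then have "card S \<le> card {s0}" by (intro card_mono) auto
    then show False using card by simp
  qed
  then have "pos s0 < pos t0" using s0(2)[OF t0(1)] pos_eq[of s0 t0] by linarith
  then have "outermost S s0 t0" using s0 t0 by (auto simp: outermost_def)
  then have ends: "s0 \<notin> N" "t0 \<notin> N" using not_outer by auto
  have step_up: "\<exists>t\<in>S. consecutive V s t" if s: "s \<in> S" "s \<in> N" for s
  proof -
    have "pos s < pos t0" using t0(2)[OF s(1)] ends s(2) pos_eq[of s t0]
      by (metis le_neq_implies_less)
    then obtain t where t: "consecutive S s t" using ex_next[OF fin s(1) t0(1)] by blast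
    then have "{s, t} \<in> polygon_sides S" unfolding polygon_sides_def by blast
    then show ?thesis using side[of s t] t s by (auto simp: consecutive_def)
  qed
  have step_down: "\<exists>t\<in>S. consecutive V t s" if s: "s \<in> S" "s \<in> N" for s
  proof -
    have "pos s0 < pos s" using s0(2)[OF s(1)] ends s(2) pos_eq[of s0 s]
      by (metis le_neq_implies_less)
    then obtain t where t: "consecutive S t s" using ex_previous[OF fin s(1) s0(1)] by blast
    then have "{t, s} \<in> polygon_sides S" unfolding polygon_sides_def by blast
    then show ?thesis using side[of t s] t s by (auto simp: consecutive_def)
  qed
  \<comment> \<open>The last vertex of \<open>S\<close> before \<open>v\<close> lies in
    \<open>N\<close>, so its successor in \<open>V\<close> belongs to \<open>S\<close> too; by
    maximality that successor is \<open>v\<close>.\<close>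
  have up: "v \<in> S" if v: "v \<in> V" "pos k < pos v" "pos v \<le> pos w" for v
  proof (rule ccontr)
    assume "v \<notin> S"
    let ?X = "{y \<in> S. pos y < pos v}"
    have "finite ?X" "?X \<noteq> {}" using fin k(1) v(2) by auto
    then obtain s where s: "s \<in> ?X" "\<And>y. y \<in> ?X \<Longrightarrow> pos y \<le> pos s"
      using ex_highest by blast
    have "pos k \<le> pos s" using s(2)[of k] k(1) v(2) by simp
    then have "s \<in> N" using s(1) k(2) v(3) SV by (auto simp: between_def)
    then obtain t where t: "t \<in> S" "consecutive V s t" using step_up s(1) by blast
    have "pos t \<le> pos v" using consecutiveD[OF t(2) v(1)] s(1) by auto
    then have "t = v" using s(2)[of t] t \<open>v \<notin> S\<close> by (fastforce simp: consecutive_def)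
    then show False using t(1) \<open>v \<notin> S\<close> by simp
  qed
  have down: "v \<in> S" if v: "v \<in> V" "pos v < pos k" "pos u \<le> pos v" for v
  proof (rule ccontr)
    assume "v \<notin> S"
    let ?X = "{y \<in> S. pos v < pos y}"
    have "finite ?X" "?X \<noteq> {}" using fin k(1) v(2) by auto
    then obtain s where s: "s \<in> ?X" "\<And>y. y \<in> ?X \<Longrightarrow> pos s \<le> pos y"
      using ex_lowest by blast
    have "pos s \<le> pos k" using s(2)[of k] k(1) v(2) by simp
    then have "s \<in> N" using s(1) k(2) v(3) SV by (auto simp: between_def)
    then obtain t where t: "t \<in> S" "consecutive V t s" using step_down s(1) by blast
    have "pos v \<le> pos t" using consecutiveD[OF t(2) v(1)] s(1) by auto
    then have "t = v" using s(2)[of t] t \<open>v \<notin> S\<close> by (fastforce simp: consecutive_def)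
    then show False using t(1) \<open>v \<notin> S\<close> by simp
  qed
  have "v \<in> S" if "v \<in> new" for v
  proof (cases "v = k")
    case False
    have "v \<in> V" "pos u \<le> pos v" "pos v \<le> pos w" using that u_w uw(2) by (auto simp: between_def)
    moreover have "pos v \<noteq> pos k" using False by simp
    ultimately show ?thesis using up[of v] down[of v] by linarith
  qed (use k in simp)
  then have sub: "new \<subseteq> S" by blast
  \<comment> \<open>Containing the chord, \<open>S\<close> has it as a side; as \<open>k\<close>
    lies in between, \<open>u\<close> and \<open>w\<close> are the extreme vertices of
    \<open>S\<close>.\<close>
  then have "{u, w} \<in> polygon_sides S" using chords' uw(1) by blast
  then obtain s t where st: "{u, w} = {s, t}" "consecutive S s t \<or> outermost S s t"
    unfolding polygon_sides_def by blast
  then have "pos s < pos t" by (auto simp: consecutive_def outermost_def)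
  then have "s = u" "t = w" using st(1) ordered_doubleton_eq[OF uw(2)] by auto
  moreover have "\<not> consecutive S u w" using k by (auto simp: consecutive_def)
  ultimately have "outermost S u w" using st(2) by auto
  then have "pos u \<le> pos y \<and> pos y \<le> pos w" if "y \<in> S" for y using that by (simp add: outermost_def)
  then have "y \<in> new" if "y \<in> S" for y
    using that SV by (force simp: between_def order.order_iff_strict)
  with sub show ?thesis by blast
qed

lemma pieces_eq: "polygon_pieces V E = insert new (polygon_pieces V' E')"
proof (rule equalityI; rule subsetI)
  fix S assume S: "S \<in> polygon_pieces V E"
  then have SV: "S \<subseteq> V" unfolding polygon_pieces_def by blast
  show "S \<in> insert new (polygon_pieces V' E')"
  proof (cases "S = new")
    case False
    then have "S \<inter> N = {}" using piece_at_N[OF S] by blast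
    then have "S \<subseteq> V'" using SV by blast
    then show ?thesis using old_piece S by blast
  qed simp
next
  fix S assume "S \<in> insert new (polygon_pieces V' E')"
  then show "S \<in> polygon_pieces V E"
  proof
    assume S: "S \<in> polygon_pieces V' E'"
    then have "S \<subseteq> V'" unfolding polygon_pieces_def by blast
    then show ?thesis using old_piece S by blast
  qed (use new_piece in simp)
qed

lemma chord_system_smaller: "chord_system a b V' E'"
proof -
  have ab: "a \<in> V" "b \<in> V" "pos a < pos b" "\<And>k. k \<in> V \<Longrightarrow> pos a \<le> pos k \<and> pos k \<le> pos b"
    "between a b \<inter> V \<noteq> {} \<Longrightarrow> {a, b} \<in> E"
    using chords by (simp_all add: chord_system_def)
  then have ab': "a \<in> V'" "b \<in> V'"
    using ab(4)[OF u_w(1)] ab(4)[OF u_w(2)] by (auto simp: between_def)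
  have long: "\<forall>e\<in>E'. \<exists>s\<in>V'. \<exists>t\<in>V'. e = {s, t} \<and> pos s < pos t \<and> between s t \<inter> V' \<noteq> {}"
  proof
    fix e assume e: "e \<in> E'"
    then have "e \<in> E" by simp
    then obtain s t k where st: "e = {s, t}" "pos s < pos t" "k \<in> V" "pos s < pos k" "pos k < pos t"
      by (rule chordE)
    have st': "s \<in> V'" "t \<in> V'" using chord_subset[of e] e st(1) by auto
    \<comment> \<open>If \<open>k\<close> is removed, \<open>u\<close> or \<open>w\<close> replaces
      it, because the chord spans the base and differs from it.\<close>
    have "between s t \<inter> V' \<noteq> {}"
    proof (cases "k \<in> N")
      case True
      then have "pos s \<le> pos u" "pos w \<le> pos t"
        using V'_pos[OF st'(1)] V'_pos[OF st'(2)] st by (auto simp: between_def)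
      moreover have "pos s \<noteq> pos u \<or> pos t \<noteq> pos w" using e st(1) by auto
      ultimately have "pos s < pos u \<and> pos u < pos t \<or> pos s < pos w \<and> pos w < pos t"
        using uw(2) by linarith
      then have "u \<in> between s t \<or> w \<in> between s t"
        by (simp add: between_def)
      then show ?thesis using u_w by blast
    qed (use st in \<open>auto simp: between_def\<close>)
    with st st' show "\<exists>s\<in>V'. \<exists>t\<in>V'. e = {s, t} \<and> pos s < pos t \<and> between s t \<inter> V' \<noteq> {}"
      by metis
  qed
  have root: "between a b \<inter> V' \<noteq> {} \<longrightarrow> {a, b} \<in> E'"
  proof
    assume that: "between a b \<inter> V' \<noteq> {}"
    then have "{a, b} \<in> E" using ab(5) by blast
    \<comment> \<open>If the base is the root, all vertices between \<open>a\<close> and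
      \<open>b\<close> are removed.\<close>
    moreover have "{a, b} \<noteq> {u, w}"
    proof
      assume "{a, b} = {u, w}"
      then have "a = u" "b = w" using ordered_doubleton_eq[OF ab(3) uw(2)] by auto
      then show False using that by blast
    qed
    ultimately show "{a, b} \<in> E'" by simp
  qed
  have nc: "\<not> (pos p < pos q \<and> pos q < pos r \<and> pos r < pos s)"
    if "{p, r} \<in> E'" "{q, s} \<in> E'" for p q r s
    using noncrossing[of p r q s] that by auto
  have bounds: "\<forall>k\<in>V'. pos a \<le> pos k \<and> pos k \<le> pos b" using ab(4) by simp
  show ?thesis
    unfolding chord_system_def
    by (intro conjI finite_Diff finite_V ab' ab(3) bounds long root allI impI nc)
qed

end

section \<open>Every dissected polygon is built from ears\<close>

context vertex_order
begin

text \<open>Induction on the number of chords: the ear under a shortest chord is removed and glued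
  back onto the polygon built from the rest.\<close>

theorem ear_built_pieces:
  assumes "chord_system a b V E"
  shows "ear_built a b V E (polygon_pieces V E)"
  using assms
proof (induction "card E" arbitrary: V E)
  case 0
  \<comment> \<open>\<open>card E = 0\<close> would also hold for infinite \<open>E\<close>, so
    finiteness comes first.\<close>
  have "E \<subseteq> Pow V"
    using 0(2) by (auto simp: chord_system_def)
  moreover have "finite V" using 0(2) by (simp add: chord_system_def)
  ultimately have "finite E" by (simp add: finite_subset)
  then have E: "E = {}" using 0 by simp
  have ab: "a \<in> V" "b \<in> V" "pos a < pos b" "\<And>k. k \<in> V \<Longrightarrow> pos a \<le> pos k \<and> pos k \<le> pos b"
    "between a b \<inter> V = {}"
    using 0(2) unfolding E by (simp_all add: chord_system_def)
  have "consecutive V a b" using ab by (simp add: consecutive_def)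
  then have "k = a \<or> k = b" if "k \<in> V" for k
    using ab(4)[OF that] consecutiveD[of V a b k] that by (metis le_antisym pos_eq)
  then have V: "V = {a, b}" using ab(1,2) by blast
  have "\<not> 3 \<le> card S" if "S \<subseteq> {a, b}" for S
  proof -
    have "card S \<le> card {a, b}" using that by (intro card_mono) auto
    then show ?thesis using ab(3) by (auto simp: card_insert_if split: if_splits)
  qed
  then have "polygon_pieces V E = {}"
    unfolding polygon_pieces_def V by blast
  then show ?case using digon[OF ab(3)] V E by simp
next
  case (Suc m)
  have "E \<noteq> {}" using Suc(2) by auto
  then obtain e where "e \<in> E" by blast
  then have "\<exists>s\<in>V. \<exists>t\<in>V. e = {s, t} \<and> pos s < pos t \<and> between s t \<inter> V \<noteq> {}"
    using Suc(3) by (simp add: chord_system_def)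
  then obtain s0 t0 where "e = {s0, t0}" "pos s0 < pos t0" by blast
  with \<open>e \<in> E\<close> have "{s0, t0} \<in> E" "pos s0 < pos t0" by simp_all
  then have "case (s0, t0) of (s, t) \<Rightarrow> {s, t} \<in> E \<and> pos s < pos t"
    by simp
  from ex_has_least_nat[where P = "\<lambda>(s, t). {s, t} \<in> E \<and> pos s < pos t"
      and m = "\<lambda>(s, t). pos t - pos s", OF this]
  obtain z where z: "(case z of (s, t) \<Rightarrow> {s, t} \<in> E \<and> pos s < pos t) \<and>
      (\<forall>y. (case y of (s, t) \<Rightarrow> {s, t} \<in> E \<and> pos s < pos t) \<longrightarrow>
        (case z of (s, t) \<Rightarrow> pos t - pos s) \<le> (case y of (s, t) \<Rightarrow> pos t - pos s))"
    by blast
  obtain u w where "z = (u, w)" by (cases z)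
  with z have uw: "{u, w} \<in> E" "pos u < pos w"
    "\<And>s t. {s, t} \<in> E \<Longrightarrow> pos s < pos t \<Longrightarrow> pos w - pos u \<le> pos t - pos s"
    by auto
  interpret shortest_chord pos a b V E u w
    by unfold_locales (fact Suc(3) uw)+
  have "card E' = m" using Suc(2) uw(1) by simp
  then have IH: "ear_built a b V' E' (polygon_pieces V' E')"
    using Suc(1) chord_system_smaller by blast
  have "consecutive V' u w"
    using u_w uw(2) by (auto simp: consecutive_def)
  then have "ear_built a b (V' \<union> N) (insert {u, w} E') (insert new (polygon_pieces V' E'))"
    using finite_V u_w(4) by (intro glue IH) auto
  moreover have "V' \<union> N = V" "insert {u, w} E' = E" using uw(1) by auto
  ultimately show ?case using pieces_eq by simp
qed

end

section \<open>Rooting the polygon at a boundary edge\<close>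

text \<open>Positions count from \<open>r\<close>; outside the polygon the identity makes the map
  injective on all natural numbers, as \<open>vertex_order\<close> demands.\<close>

definition rotation :: "nat \<Rightarrow> nat \<Rightarrow> nat \<Rightarrow> nat" where
  "rotation n r k = (if k < n then ccw_dist n r k else k)"

lemma ccw_dist_eq: "i < n \<Longrightarrow> j < n \<Longrightarrow> ccw_dist n i j = (if i \<le> j then j - i else n + j - i)"
  unfolding ccw_dist_def by (auto simp: mod_if)

lemma rotation_eq:
  "r < n \<Longrightarrow> k < n \<Longrightarrow> rotation n r k = (if r \<le> k then k - r else n + k - r)"
  by (simp add: rotation_def ccw_dist_eq)

lemma rotation_less: "r < n \<Longrightarrow> k < n \<Longrightarrow> rotation n r k < n"
  by (simp add: rotation_def ccw_dist_def)

lemma rotation_inject: "r < n \<Longrightarrow> s < n \<Longrightarrow> t < n \<Longrightarrow> rotation n r s = rotation n r t \<longleftrightarrow> s = t"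
  by (auto simp: rotation_eq split: if_splits)

lemma inj_rotation:
  assumes "r < n"
  shows "inj (rotation n r)"
proof (rule injI)
  fix s t assume eq: "rotation n r s = rotation n r t"
  consider "s < n" "t < n" | "s < n" "\<not> t < n" | "\<not> s < n" "t < n" | "\<not> s < n" "\<not> t < n" by blast
  then show "s = t"
  proof cases
    case 1
    then show ?thesis using eq rotation_inject assms by blast
  next
    case 2
    then show ?thesis using eq rotation_less[OF assms 2(1)] by (simp add: rotation_def[of n r t])
  next
    case 3
    then show ?thesis using eq rotation_less[OF assms 3(2)] by (simp add: rotation_def[of n r s])
  next
    case 4
    then show ?thesis using eq by (simp add: rotation_def)
  qed
qed

lemma ccw_dist_rotation:
  assumes "r < n" "s < n" "t < n"
  shows "ccw_dist n s t = (if rotation n r s \<le> rotation n r t then rotation n r t - rotation n r s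
    else n + rotation n r t - rotation n r s)"
  using assms by (simp add: rotation_eq ccw_dist_eq; linarith)

lemma rotation_succ:
  assumes "r < n" "s < n"
  shows "succ_vertex n s < n"
    "rotation n r (succ_vertex n s) = (if rotation n r s = n - 1 then 0 else rotation n r s + 1)"
proof -
  have s: "succ_vertex n s = (if s + 1 = n then 0 else s + 1)"
    using assms by (simp add: succ_vertex_def)
  then show "succ_vertex n s < n" using assms by simp
  then show "rotation n r (succ_vertex n s) = (if rotation n r s = n - 1 then 0 else rotation n r s + 1)"
    using assms s by (simp add: rotation_eq) (auto split: if_splits)
qed

lemma rotation_less_iff:
  "r < n \<Longrightarrow> s < n \<Longrightarrow> t < n \<Longrightarrow>
    rotation n r s < rotation n r t \<longleftrightarrow> (if r \<le> s then t < r \<or> s < t else t < r \<and> s < t)"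
  by (simp add: rotation_eq; linarith)

lemma crossingI:
  assumes "p < q" "q < c" "c < d"
  shows "crossing {p, c} {q, d}" "crossing {q, d} {p, c}"
  using assms unfolding crossing_def by blast+

text \<open>\<open>crossing\<close> compares labels, not positions. A rotation shifts the four
  labels cyclically, and in each of the four shifts the two pairs still alternate.\<close>

lemma rotation_crossing:
  assumes "r < n" "p < n" "q < n" "c < n" "d < n"
    "rotation n r p < rotation n r q" "rotation n r q < rotation n r c" "rotation n r c < rotation n r d"
  shows "crossing {p, c} {q, d}"
proof -
  have "p < q \<and> q < c \<and> c < d \<or> d < p \<and> p < q \<and> q < c \<or> c < d \<and> d < p \<and> p < q \<or> q < c \<and> c < d \<and> d < p"
    using assms(6-8) unfolding rotation_less_iff[OF assms(1-3)] rotation_less_iff[OF assms(1,3,4)]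
      rotation_less_iff[OF assms(1,4,5)] by (simp split: if_splits; linarith)
  then consider "p < q" "q < c" "c < d" | "d < p" "p < q" "q < c" | "c < d" "d < p" "p < q"
    | "q < c" "c < d" "d < p"
    by blast
  then show ?thesis
  proof cases
    case 1
    then show ?thesis by (rule crossingI(1))
  next
    case 2
    from crossingI(2)[OF this] show ?thesis by (simp add: insert_commute)
  next
    case 3
    from crossingI(1)[OF this] show ?thesis by (simp add: insert_commute)
  next
    case 4
    from crossingI(2)[OF this] show ?thesis by (simp add: insert_commute)
  qed
qed

lemma det_two:
  fixes p q s t :: "'a :: comm_ring_1"
  shows "det (mat_of_rows_list 2 [[p, q], [s, t]]) = p * t - q * s"
proof -
  define A where "A = mat_of_rows_list 2 [[p, q], [s, t]]"
  have dim: "A \<in> carrier_mat 2 2" "dim_row A = 2" "dim_col A = 2"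
    and entries: "A $$ (0, 0) = p" "A $$ (0, 1) = q" "A $$ (1, 0) = s" "A $$ (1, 1) = t"
    by (auto simp: A_def mat_of_rows_list_def)
  have minors: "det (mat_delete A 0 0) = A $$ (1, 1)" "det (mat_delete A 0 1) = A $$ (1, 0)"
    by (subst det_single; simp add: mat_delete_def dim)+
  have "det A = (\<Sum>l<2. A $$ (0, l) * cofactor A 0 l)"
    by (rule laplace_expansion_row[OF dim(1)]) simp
  also have "\<dots> = A $$ (0, 0) * cofactor A 0 0 + A $$ (0, 1) * cofactor A 0 1"
    by (simp only: numeral_2_eq_2 sum.lessThan_Suc) simp
  finally show ?thesis
    unfolding cofactor_def minors entries A_def[symmetric] by simp
qed

section \<open>The dissected polygon in the linear order from \<open>r = i + 1\<close> to
  \<open>i\<close>\<close>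

locale rooted_polygon =
  fixes n i r :: nat and \<Delta>
  assumes n: "3 \<le> n" and dissection: "dissection n \<Delta>" and i: "i < n" and r: "r = succ_vertex n i"
begin

abbreviation "V \<equiv> {..<n}"
abbreviation "pos \<equiv> rotation n r"

lemma r_less: "r < n" using n r by (simp add: succ_vertex_def)

sublocale vertex_order pos
  by unfold_locales (rule inj_rotation[OF r_less])

lemma pos_r: "pos r = 0" using r_less by (simp add: rotation_eq)

lemma pos_i: "pos i = n - 1"
  using rotation_succ(2)[OF r_less i] pos_r unfolding r[symmetric] by (simp split: if_splits)

lemma pos_less: "k < n \<Longrightarrow> pos k < n" by (rule rotation_less[OF r_less])

lemma pos_le_i: "k < n \<Longrightarrow> pos k \<le> pos i"
  using pos_less[of k] pos_i by simp

lemma pos_succ: "k < n \<Longrightarrow> k \<noteq> i \<Longrightarrow> pos (succ_vertex n k) = Suc (pos k)"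
  using rotation_succ(2)[OF r_less, of k] pos_i pos_eq[of k i] by (simp split: if_splits)

lemma succ_less: "k < n \<Longrightarrow> succ_vertex n k < n"
  by (rule rotation_succ(1)[OF r_less])

lemma ccw_between_eq:
  assumes "s < n" "t < n"
  shows "ccw_between n s t = (if pos s < pos t then {k \<in> V. pos s < pos k \<and> pos k < pos t}
     else if s = t then {} else {k \<in> V. pos s < pos k \<or> pos k < pos t})"
proof -
  have iff: "0 < ccw_dist n s k \<and> ccw_dist n s k < ccw_dist n s t \<longleftrightarrow>
    (if pos s < pos t then pos s < pos k \<and> pos k < pos t
     else if s = t then False else pos s < pos k \<or> pos k < pos t)" if "k < n" for k
  proof -
    have "(s = t) \<longleftrightarrow> pos s = pos t" by simp
    then show ?thesis
      unfolding ccw_dist_rotation[OF r_less assms] ccw_dist_rotation[OF r_less assms(1) that]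
      using pos_less[OF assms(1)] pos_less[OF assms(2)] pos_less[OF that]
      by (simp only:) (simp split: if_splits; linarith)
  qed
  show ?thesis
  proof (rule Set.set_eqI)
    fix k show "k \<in> ccw_between n s t \<longleftrightarrow> k \<in> (if pos s < pos t then {k \<in> V. pos s < pos k \<and> pos k < pos t}
        else if s = t then {} else {k \<in> V. pos s < pos k \<or> pos k < pos t})"
      using iff[of k] by (cases "k < n") (simp_all add: ccw_between_def)
  qed
qed

lemma consecutive_iff: "consecutive V s t \<longleftrightarrow> s < n \<and> s \<noteq> i \<and> t = succ_vertex n s"
proof
  assume st: "consecutive V s t"
  then have s: "s < n" "t < n" "pos s < pos t" by (auto simp: consecutive_def)
  then have "s \<noteq> i" using pos_le_i[of t] by auto
  moreover have "pos t = Suc (pos s)"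
    using consecutiveD[OF st, of "succ_vertex n s"] succ_less[OF s(1)] pos_succ[OF s(1) \<open>s \<noteq> i\<close>] s by simp
  then have "pos t = pos (succ_vertex n s)" using pos_succ[OF s(1) \<open>s \<noteq> i\<close>] by simp
  ultimately show "s < n \<and> s \<noteq> i \<and> t = succ_vertex n s" using s by simp
next
  assume "s < n \<and> s \<noteq> i \<and> t = succ_vertex n s"
  then show "consecutive V s t"
    using succ_less[of s] pos_succ[of s] by (auto simp: consecutive_def between_def)
qed

lemma boundary_edges_eq: "boundary_edges n = {{s, t} |s t. consecutive V s t} \<union> {{r, i}}"
proof -
  have "boundary_edges n = {{s, t} |s t. s < n \<and> t = succ_vertex n s}"
    by (auto simp: boundary_edges_def boundary_edge_def)
  also have "\<dots> = {{s, t} |s t. consecutive V s t} \<union> {{r, i}}"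
  proof -
    have root: "{r, i} = {i, succ_vertex n i}" by (simp add: r insert_commute)
    show ?thesis unfolding consecutive_iff root using i by blast
  qed
  finally show ?thesis .
qed

text \<open>Of the two arcs joining \<open>s\<close> and \<open>t\<close>, one avoids the root edge
  and the other runs through it; emptiness of the former amounts to \<open>consecutive\<close>, of
  the latter to \<open>outermost\<close>.\<close>

lemma sides_eq:
  assumes "S \<subseteq> V"
  shows "sides n S = polygon_sides S"
proof -
  have up: "ccw_between n s t \<inter> S = {} \<longleftrightarrow> consecutive S s t"
    if "s \<in> S" "t \<in> S" "pos s < pos t" for s t
  proof -
    have "s < n" "t < n" using that assms by auto
    then have "ccw_between n s t \<inter> S = between s t \<inter> S"
      using that(3) assms by (auto simp: ccw_between_eq between_def)
    then show ?thesis using that by (simp add: consecutive_def)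
  qed
  have down: "ccw_between n t s \<inter> S = {} \<longleftrightarrow> outermost S s t"
    if "s \<in> S" "t \<in> S" "pos s < pos t" for s t
  proof -
    have "s < n" "t < n" "s \<noteq> t" using that assms by auto
    then have "ccw_between n t s \<inter> S = {k \<in> S. pos t < pos k \<or> pos k < pos s}"
      using that(3) assms by (auto simp: ccw_between_eq)
    then show ?thesis using that by (auto simp: outermost_def not_less)
  qed
  show ?thesis
  proof (rule equalityI; rule subsetI)
    fix e assume "e \<in> sides n S"
    then obtain s t where e: "e = {s, t}" "s \<in> S" "t \<in> S" "s \<noteq> t" "ccw_between n s t \<inter> S = {}"
      by (auto simp: sides_def)
    have "pos s < pos t \<or> pos t < pos s" using e(4) pos_eq[of s t] by linarith
    then have "consecutive S s t \<or> outermost S t s"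
      using up[OF e(2,3)] down[OF e(3,2)] e(5) by blast
    then show "e \<in> polygon_sides S"
      unfolding polygon_sides_def e(1) by (auto simp: insert_commute)
  next
    fix e assume "e \<in> polygon_sides S"
    then obtain s t where e: "e = {s, t}" "consecutive S s t \<or> outermost S s t"
      by (auto simp: polygon_sides_def)
    then have st: "s \<in> S" "t \<in> S" "pos s < pos t" by (auto simp: consecutive_def outermost_def)
    then have "s \<noteq> t" by auto
    have "ccw_between n s t \<inter> S = {} \<or> ccw_between n t s \<inter> S = {}"
      using up[OF st] down[OF st] e(2) by blast
    then show "e \<in> sides n S"
      unfolding sides_def e(1) using st \<open>s \<noteq> t\<close> by (blast intro: insert_commute)
  qed
qed

text \<open>The root joins the drawn diagonals as the base of the first ear.\<close>

abbreviation "E \<equiv> insert {r, i} \<Delta>"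

lemma root_less: "pos r < pos i" using pos_r pos_i n by simp

lemma diagonalE:
  assumes "e \<in> \<Delta>"
  obtains s t where "e = {s, t}" "s < n" "t < n" "pos s < pos t" "e \<notin> boundary_edges n"
proof -
  have "e \<in> diagonals n" using dissection assms by (auto simp: dissection_def)
  then obtain s t where st: "e = {s, t}" "s < n" "t < n" "s \<noteq> t" "e \<notin> boundary_edges n"
    by (auto simp: diagonals_def)
  then have "pos s < pos t \<or> pos t < pos s" using pos_eq[of s t] by linarith
  then show thesis
    using that[of s t] that[of t s] st by (auto simp: insert_commute)
qed

lemma root_notin: "{r, i} \<notin> \<Delta>"
  using boundary_edges_eq by (auto elim: diagonalE)

lemma crossing_free:
  assumes "{p, c} \<in> \<Delta>" "{q, d} \<in> \<Delta>"
  shows "\<not> (pos p < pos q \<and> pos q < pos c \<and> pos c < pos d)"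
proof
  assume "pos p < pos q \<and> pos q < pos c \<and> pos c < pos d"
  moreover have "p < n" "c < n" "q < n" "d < n"
    using diagonalE[OF assms(1)] diagonalE[OF assms(2)] by (auto simp: doubleton_eq_iff)
  ultimately have "crossing {p, c} {q, d}"
    using rotation_crossing[OF r_less] by blast
  then show False using dissection assms by (auto simp: dissection_def)
qed

lemma chords: "chord_system r i V E"
proof -
  have bounds: "\<forall>k\<in>V. pos r \<le> pos k \<and> pos k \<le> pos i"
    using pos_r pos_le_i by simp
  have "between r i \<inter> V \<noteq> {}"
  proof -
    have "pos (succ_vertex n r) = 1"
      using pos_succ[OF r_less] root_less pos_r by force
    then have "succ_vertex n r \<in> between r i \<inter> V"
      using succ_less[OF r_less] pos_r pos_i n by (simp add: between_def)
    then show ?thesis by blast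
  qed
  then have root: "\<exists>s\<in>V. \<exists>t\<in>V. {r, i} = {s, t} \<and> pos s < pos t \<and> between s t \<inter> V \<noteq> {}"
    using r_less i root_less by blast
  have long: "\<exists>s\<in>V. \<exists>t\<in>V. e = {s, t} \<and> pos s < pos t \<and> between s t \<inter> V \<noteq> {}" if e: "e \<in> \<Delta>" for e
  proof -
    obtain s t where st: "e = {s, t}" "s < n" "t < n" "pos s < pos t" "e \<notin> boundary_edges n"
      by (rule diagonalE[OF e])
    then have "\<not> consecutive V s t" unfolding boundary_edges_eq by blast
    then have "between s t \<inter> V \<noteq> {}" using st by (auto simp: consecutive_def)
    then show ?thesis using st by blast
  qed
  have nc: "\<not> (pos p < pos q \<and> pos q < pos c \<and> pos c < pos d)" if "{p, c} \<in> E" "{q, d} \<in> E" for p q c d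
  proof
    assume less: "pos p < pos q \<and> pos q < pos c \<and> pos c < pos d"
    have vertices: "k < n" if "{k, l} \<in> E \<or> {l, k} \<in> E" for k l
      using that i r_less by (auto simp: doubleton_eq_iff elim: diagonalE)
    have "p < n" "c < n" "q < n" "d < n" using that vertices by blast+
    \<comment> \<open>The root takes part in no crossing: its ends come first and last, whereas
      \<open>q\<close> and \<open>c\<close> lie strictly in between.\<close>
    then have "pos d \<le> pos i" "pos r \<le> pos p" using pos_le_i pos_r by auto
    then have "c \<noteq> i" "q \<noteq> r" "q \<noteq> i" "c \<noteq> r" using less by auto
    then have "{p, c} \<in> \<Delta>" "{q, d} \<in> \<Delta>" using that by (auto simp: doubleton_eq_iff)
    then show False using crossing_free less by blast
  qed
  show ?thesis
    unfolding chord_system_def using r_less i root_less bounds root long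
    by (intro conjI allI impI nc) auto
qed

text \<open>The root is a boundary edge, and a polygon with both its ends has it as outermost side,
  so treating it as a chord changes nothing.\<close>

lemma pieces_eq_polygon_pieces: "pieces n \<Delta> = polygon_pieces V E"
proof -
  have root: "{r, i} \<in> polygon_sides S" if "{r, i} \<subseteq> S" "S \<subseteq> V" for S
  proof -
    have "outermost S r i" using that root_less pos_r pos_le_i by (auto simp: outermost_def)
    then show ?thesis unfolding polygon_sides_def by blast
  qed
  have "S \<in> pieces n \<Delta> \<longleftrightarrow> S \<in> polygon_pieces V E" for S
  proof (cases "S \<subseteq> V")
    case True
    have "(polygon_sides S \<subseteq> boundary_edges n \<union> \<Delta>) \<longleftrightarrow>
        (\<forall>e\<in>polygon_sides S. e \<in> E \<or> (\<exists>s t. e = {s, t} \<and> consecutive V s t))"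
      unfolding boundary_edges_eq by blast
    moreover have "(\<forall>\<delta>\<in>\<Delta>. \<delta> \<subseteq> S \<longrightarrow> \<delta> \<in> polygon_sides S) \<longleftrightarrow>
        (\<forall>\<delta>\<in>E. \<delta> \<subseteq> S \<longrightarrow> \<delta> \<in> polygon_sides S)"
      using root[OF _ True] by blast
    ultimately show ?thesis
      using True by (simp only: pieces_def polygon_pieces_def mem_Collect_eq sides_eq[OF True])
  next
    case False
    then show ?thesis by (simp add: pieces_def polygon_pieces_def)
  qed
  then show ?thesis by blast
qed

abbreviation "P \<equiv> pieces n \<Delta>"

lemma built: "ear_built r i V E P"
  using ear_built_pieces[OF chords] pieces_eq_polygon_pieces by simp

lemma zigzag_exists_iff: "zigzag_exists n \<Delta> e f \<longleftrightarrow> zigzag (E - {{r, i}}) P e f"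
proof -
  have D: "E - {{r, i}} = \<Delta>" using root_notin by auto
  have S: "sides n (ps ! k) = polygon_sides (ps ! k)" if "set ps \<subseteq> P" "k < length ps" for ps k
  proof -
    have "ps ! k \<in> P" using that by auto
    then show ?thesis by (intro sides_eq) (simp add: pieces_def)
  qed
  have "zigzag_sequence n \<Delta> e f zs ps \<longleftrightarrow> zigzag_via \<Delta> P e f zs ps" for zs ps
  proof (cases "set ps \<subseteq> P")
    case True
    then show ?thesis
      unfolding zigzag_sequence_def zigzag_via_def using S[OF True] by auto
  qed (simp add: zigzag_sequence_def zigzag_via_def)
  then show ?thesis by (simp add: zigzag_exists_def zigzag_def D)
qed

section \<open>Matrix entries and minors in terms of columns\<close>

definition "below j = {k \<in> V. pos k < pos j}"

text \<open>The q-weight of the boundary path from \<open>r\<close> to \<open>j\<close>.\<close>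

definition "Q j = (\<Prod>k\<in>below j. q_var k)"

lemma matrix_entry:
  assumes "s < n" "t < n" "s \<noteq> t"
  shows "weight_matrix n \<Delta> $$ (s, t) =
    assignment_sum x_var P (ccw_between n s t) * (\<Prod>k\<in>insert s (ccw_between n s t). q_var k)"
proof -
  have "walks n \<Delta> s t = assignments P (ccw_between n s t)"
    using assms(3) by (simp add: walks_def assignments_def)
  then show ?thesis
    using assms by (simp add: weight_matrix_def walk_weight_def assignment_sum_def sum_distrib_right)
qed

lemma matrix_diagonal: "s < n \<Longrightarrow> weight_matrix n \<Delta> $$ (s, s) = 0"
  by (simp add: weight_matrix_def walks_def)

lemma finite_below: "finite (below j)"
  by (simp add: below_def)

lemma i_notin_below: "j < n \<Longrightarrow> i \<notin> below j"
  using pos_le_i[of j] by (simp add: below_def not_less)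

lemma ccw_between_i:
  assumes "j < n" "j \<noteq> i"
  shows "ccw_between n i j = below j"
proof -
  have "\<not> pos i < pos k" if "k < n" for k using pos_le_i[OF that] by simp
  then show ?thesis using assms i by (auto simp: ccw_between_eq below_def)
qed

lemma upper_row:
  assumes "j < n"
  shows "weight_matrix n \<Delta> $$ (i, j) = column x_var UNIV P V j * (q_var i * Q j)"
proof (cases "j = i")
  \<comment> \<open>The entry is \<open>0\<close> by convention, and the column vanishes too, since
    the vertices other than \<open>i\<close> outnumber the uses of the pieces.\<close>
  case True
  then show ?thesis
    using matrix_diagonal[OF i] ear_built_column(1)[OF built, of x_var] by simp
next
  case False
  have "column x_var UNIV P V j = assignment_sum x_var P (below j)"
    by (simp add: column_def below_def)
  moreover have "(\<Prod>k\<in>insert i (below j). q_var k) = q_var i * Q j"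
    unfolding Q_def by (rule prod.insert[OF finite_below i_notin_below[OF assms]])
  ultimately show ?thesis
    using matrix_entry[OF i assms] False unfolding ccw_between_i[OF assms False] by simp
qed

lemma lower_row:
  assumes "j < n"
  shows "weight_matrix n \<Delta> $$ (r, j) = column x_var (- {r}) P V j * Q j"
proof (cases "j = r")
  \<comment> \<open>Both sides are \<open>0\<close> by convention, as \<open>r\<close> is not in
    \<open>- {r}\<close>.\<close>
  case True
  then show ?thesis
    using matrix_diagonal[OF r_less] by (simp add: column_def)
next
  case False
  then have j: "pos r < pos j" using pos_r pos_eq[of j r] by linarith
  have zero: "0 < pos k \<longleftrightarrow> k \<noteq> r" for k using pos_eq[of k r] pos_r by linarith
  have between: "ccw_between n r j = {k \<in> V \<inter> - {r}. pos k < pos j}"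
    unfolding ccw_between_eq[OF r_less assms] pos_r zero using False by auto
  have "insert r {k \<in> V \<inter> - {r}. pos k < pos j} = below j"
    unfolding below_def using r_less j by blast
  then show ?thesis
    using matrix_entry[OF r_less assms] False unfolding between Q_def
    by (simp add: column_def)
qed

lemma edge_minor_eq:
  assumes "j < n"
  shows "edge_minor n \<Delta> i j = column x_var UNIV P V j * (q_var i * Q j) *
      (weight_matrix n \<Delta> $$ (r, succ_vertex n j)) -
    (weight_matrix n \<Delta> $$ (i, succ_vertex n j)) * (column x_var (- {r}) P V j * Q j)"
  unfolding edge_minor_def Let_def det_two r[symmetric] upper_row[OF assms] lower_row[OF assms] ..

text \<open>As \<open>v_{r,r} = 0\<close>, only the product of \<open>v_{i,r} = q_i\<close> and
  \<open>v_{r,i}\<close> remains, with a minus sign; a walk from \<open>r\<close> to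
  \<open>i\<close> exhausts every piece.\<close>

lemma minor_diagonal: "edge_minor n \<Delta> i i = - (edge_weight_product n * piece_weight_product n \<Delta>)"
proof -
  have "pos k < pos i \<longleftrightarrow> k \<noteq> i" if "k < n" for k
    using pos_le_i[OF that] pos_eq[of k i] by linarith
  then have "insert i (below i) = {..<n}" using i by (auto simp: below_def)
  then have "edge_weight_product n = (\<Prod>k\<in>insert i (below i). q_var k)"
    by (simp add: edge_weight_product_def)
  then have "edge_weight_product n = q_var i * Q i"
    using finite_below[of i] i_notin_below[OF i] by (simp add: Q_def)
  moreover have "Q r = 1" "column x_var UNIV P V r = 1"
    by (simp_all add: Q_def column_def below_def pos_r)
  moreover have "column x_var (- {r}) P V i = piece_weight_product n \<Delta>"
    unfolding piece_weight_product_def by (rule ear_built_column(2)[OF built])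
  moreover have "weight_matrix n \<Delta> $$ (r, r) = 0" by (rule matrix_diagonal[OF r_less])
  ultimately show ?thesis
    using edge_minor_eq[OF i] upper_row[OF r_less] unfolding r[symmetric] by (simp add: algebra_simps)
qed

text \<open>From \<open>j + 1\<close> to \<open>i\<close> the route does not pass the root edge, so
  it is a final segment of the linear order.\<close>

lemma zig_pieces_eq:
  assumes "j < n" "j \<noteq> i"
  shows "zig_pieces n \<Delta> i j = zig P (succ_vertex n j)"
proof -
  let ?j = "succ_vertex n j"
  have j: "?j < n" using succ_less[OF assms(1)] .
  have "ccw_dist n ?j k \<le> ccw_dist n ?j i \<longleftrightarrow> pos ?j \<le> pos k" if "k < n" for k
    unfolding ccw_dist_rotation[OF r_less j that] ccw_dist_rotation[OF r_less j i]
    using pos_le_i[OF j] pos_le_i[OF that] pos_less[OF that] pos_less[OF j] pos_i by auto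
  then have "ccw_route n ?j i = {k \<in> V. pos ?j \<le> pos k}"
    by (auto simp: ccw_route_def)
  moreover have "\<beta> \<subseteq> V" if "\<beta> \<in> P" for \<beta> using that by (simp add: pieces_def)
  ultimately have "\<beta> \<inter> ccw_route n ?j i = \<beta> \<inter> {k. pos ?j \<le> pos k}" if "\<beta> \<in> P" for \<beta>
    using that by blast
  then show ?thesis by (auto simp: zig_pieces_def zig_def)
qed

lemma minor_off_diagonal:
  assumes "j < n" "j \<noteq> i"
  shows "edge_minor n \<Delta> i j =
    (if zigzag_exists n \<Delta> (boundary_edge n i) (boundary_edge n j) then
       q_var i * q_var j * (\<Prod>k\<in>ccw_between n i j. q_var k ^ 2) *
         (\<Prod>\<beta>\<in>zig_pieces n \<Delta> i j. x_var \<beta> ^ (2 * (degree_of_piece \<beta> - 2)))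
     else 0)"
proof -
  let ?j = "succ_vertex n j"
  have j: "?j < n" using succ_less[OF assms(1)] .
  have "below ?j = insert j (below j)"
    using assms pos_succ[OF assms] by (auto simp: below_def less_Suc_eq)
  then have Q: "Q ?j = q_var j * Q j"
    using finite_below[of j] by (simp add: Q_def) (simp add: below_def)
  have Q2: "(\<Prod>k\<in>ccw_between n i j. q_var k ^ 2) = Q j * Q j"
    by (simp add: ccw_between_i[OF assms] Q_def power2_eq_square prod.distrib)
  \<comment> \<open>\<open>Q j\<close> is a factor of both columns, \<open>q_j\<close> of the second
    one only, and \<open>q_i\<close> of the row of \<open>i\<close>.\<close>
  have "edge_minor n \<Delta> i j = q_var i * q_var j * (Q j * Q j) * minor x_var r P V j ?j"
    unfolding edge_minor_eq[OF assms(1)] upper_row[OF j] lower_row[OF j] minor_def Q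
    by (simp add: algebra_simps)
  moreover have "consecutive V j ?j" using assms by (simp add: consecutive_iff)
  moreover have "boundary_edge n i = {r, i}" by (simp add: boundary_edge_def r insert_commute)
  ultimately show ?thesis
    using ear_built_minor[OF built, of j ?j x_var]
    by (simp add: boundary_edge_def[of n j] zigzag_exists_iff zig_weight_def zig_pieces_eq[OF assms] Q2)
qed

end

section \<open>The minors\<close>

text \<open>A product of indeterminates is a monomial with coefficient 1 and hence nonzero; so the
  formula of (c) yields the nonvanishing in (b).\<close>

definition monomial :: "weight_poly \<Rightarrow> bool" where
  "monomial p \<longleftrightarrow> (\<exists>m. p = Poly_Mapping.single m 1)"

lemma monomial_nonzero: "monomial p \<Longrightarrow> p \<noteq> 0"
  by (auto simp: monomial_def)

lemma monomial_one: "monomial 1"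
  unfolding monomial_def by (metis single_one)

lemma monomial_mult: "monomial p \<Longrightarrow> monomial q \<Longrightarrow> monomial (p * q)"
  unfolding monomial_def by (metis mult_single mult_1)

lemma monomial_power: "monomial p \<Longrightarrow> monomial (p ^ k)"
  by (induction k) (auto intro: monomial_one monomial_mult)

lemma monomial_prod: "(\<And>k. k \<in> A \<Longrightarrow> monomial (f k)) \<Longrightarrow> monomial (prod f A)"
  by (induction A rule: infinite_finite_induct) (auto intro: monomial_one monomial_mult)

lemma monomial_vars: "monomial (x_var \<alpha>)" "monomial (q_var k)"
  by (auto simp: monomial_def x_var_def q_var_def indet_poly_def)

theorem theorem5p1:
  fixes n :: nat and \<Delta> :: "nat set set"
  assumes "3 \<le> n" and "dissection n \<Delta>"
  shows "(\<forall>i<n. edge_minor n \<Delta> i i = - (edge_weight_product n * piece_weight_product n \<Delta>)) \<and>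
    (\<forall>i<n. \<forall>j<n. boundary_edge n i \<noteq> boundary_edge n j \<longrightarrow>
       (edge_minor n \<Delta> i j \<noteq> 0 \<longleftrightarrow>
          zigzag_exists n \<Delta> (boundary_edge n i) (boundary_edge n j))) \<and>
    (\<forall>i<n. \<forall>j<n. boundary_edge n i \<noteq> boundary_edge n j \<longrightarrow>
       zigzag_exists n \<Delta> (boundary_edge n i) (boundary_edge n j) \<longrightarrow>
       edge_minor n \<Delta> i j =
         q_var i * q_var j * (\<Prod>k\<in>ccw_between n i j. q_var k ^ 2) *
         (\<Prod>\<beta>\<in>zig_pieces n \<Delta> i j. x_var \<beta> ^ (2 * (degree_of_piece \<beta> - 2))))"
proof -
  have rooted: "rooted_polygon n i (succ_vertex n i) \<Delta>" if "i < n" for i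
    using assms that by unfold_locales auto
  \<comment> \<open>Distinct boundary edges have distinct indices, and one dichotomy then serves
    both (b) and (c).\<close>
  have minor: "edge_minor n \<Delta> i j =
    (if zigzag_exists n \<Delta> (boundary_edge n i) (boundary_edge n j) then
       q_var i * q_var j * (\<Prod>k\<in>ccw_between n i j. q_var k ^ 2) *
         (\<Prod>\<beta>\<in>zig_pieces n \<Delta> i j. x_var \<beta> ^ (2 * (degree_of_piece \<beta> - 2)))
     else 0)" if "i < n" "j < n" "boundary_edge n i \<noteq> boundary_edge n j" for i j
    using that by (intro rooted_polygon.minor_off_diagonal[OF rooted]) auto
  have nonzero: "q_var i * q_var j * (\<Prod>k\<in>ccw_between n i j. q_var k ^ 2) *
         (\<Prod>\<beta>\<in>zig_pieces n \<Delta> i j. x_var \<beta> ^ (2 * (degree_of_piece \<beta> - 2))) \<noteq> 0" for i j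
    by (intro monomial_nonzero monomial_mult monomial_prod monomial_power monomial_vars)
  show ?thesis
  proof (intro conjI allI impI)
    fix i assume "i < n"
    then show "edge_minor n \<Delta> i i = - (edge_weight_product n * piece_weight_product n \<Delta>)"
      by (rule rooted_polygon.minor_diagonal[OF rooted])
  next
    fix i j assume ij: "i < n" "j < n" "boundary_edge n i \<noteq> boundary_edge n j"
    show "edge_minor n \<Delta> i j \<noteq> 0 \<longleftrightarrow> zigzag_exists n \<Delta> (boundary_edge n i) (boundary_edge n j)"
      unfolding minor[OF ij] using nonzero[of i j]
      by (cases "zigzag_exists n \<Delta> (boundary_edge n i) (boundary_edge n j)")
        (simp_all only: if_True if_False simp_thms)
  next
    fix i j assume ij: "i < n" "j < n" "boundary_edge n i \<noteq> boundary_edge n j"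
      and zigzag: "zigzag_exists n \<Delta> (boundary_edge n i) (boundary_edge n j)"
    show "edge_minor n \<Delta> i j =
         q_var i * q_var j * (\<Prod>k\<in>ccw_between n i j. q_var k ^ 2) *
         (\<Prod>\<beta>\<in>zig_pieces n \<Delta> i j. x_var \<beta> ^ (2 * (degree_of_piece \<beta> - 2)))"
      unfolding minor[OF ij] if_P[OF zigzag] ..
  qed
qed

end
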